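(* Let $n\ge2$, let $D\subset\mathbb{R}^n$ be a bounded connected open set with Lipschitz boundary, let $\omega_n$ be the volume of the unit ball in $\mathbb{R}^n$ and $R=(|D|/\omega_n)^{1/n}$. Let $(\lambda_k,u_k)$ be the $k$-th eigenvalue-eigenfunction pair of the Dirichlet Laplace operator in $D$, i.e. $u_k\in H^1_0(D)$, $u_k\neq 0$, and $$-\Delta u_k=\lambda_ku_k\ \text{ in } D,\qquad u_k=0\ \text{ on }\partial D.$$ Then $$\|u_k\|_\infty\le\frac{2}{n^n(n-2)\omega_n}\left[\lambda_k^{\frac n2}\big((n-1)^2+1\big)^{\frac n2}-\frac{\lambda_kn^{n-1}}{R^{n-2}}\right]\|u_k\|_1\quad\text{for } n>2,$$ $$\|u_k\|_\infty\le\lambda_k\left(\ln\pi+\frac1\pi(1+\ln R)+\frac{\lambda_k}{8\pi^2}\right)\|u_k\|_1\quad\text{for } n=2.$$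
   Context: $|D|$ is Lebesgue measure; $\|\cdot\|_p$ is the norm of $L^p(D)$. *)

theory Defs
  imports "HOL-Analysis.Analysis" "HOL-Probability.Essential_Supremum"
begin

section \<open>Domains with Lipschitz boundary\<close>

text \<open>Near each boundary point and in suitable orthonormal coordinates, \<open>D\<close> is the strict
  epigraph of a Lipschitz function. The unit vector \<open>e\<close> is the vertical direction,
  \<open>y - (y \<bullet> e) *\<^sub>R e\<close> is the horizontal part of \<open>y\<close>, and only the values of \<open>\<gamma>\<close> on the
  hyperplane orthogonal to \<open>e\<close> matter.\<close>

definition lipschitz_boundary :: "'a::euclidean_space set \<Rightarrow> bool"
  where "lipschitz_boundary D \<longleftrightarrow>
    (\<forall>x\<in>frontier D. \<exists>e r L \<gamma>. norm e = 1 \<and> 0 < r \<and> L-lipschitz_on {y. y \<bullet> e = 0} \<gamma> \<and>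
       D \<inter> ball x r = {y \<in> ball x r. \<gamma> (y - (y \<bullet> e) *\<^sub>R e) < y \<bullet> e})"

section \<open>Test functions\<close>

primrec continuously_differentiable :: "nat \<Rightarrow> ('a::euclidean_space \<Rightarrow> real) \<Rightarrow> bool"
  where
    "continuously_differentiable 0 f \<longleftrightarrow> continuous_on UNIV f"
  | "continuously_differentiable (Suc k) f \<longleftrightarrow>
       (\<forall>x. f differentiable (at x)) \<and>
       (\<forall>b\<in>Basis. continuously_differentiable k (\<lambda>x. frechet_derivative f (at x) b))"

definition gradient :: "('a::euclidean_space \<Rightarrow> real) \<Rightarrow> 'a \<Rightarrow> 'a"
  where "gradient f x = (\<Sum>b\<in>Basis. frechet_derivative f (at x) b *\<^sub>R b)"

text \<open>The space of smooth functions with compact support in \<open>D\<close>; its members are functions on the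
  whole space that vanish outside \<open>D\<close>.\<close>

definition test_functions :: "'a::euclidean_space set \<Rightarrow> ('a \<Rightarrow> real) set"
  where "test_functions D =
    {\<phi>. (\<forall>k. continuously_differentiable k \<phi>) \<and>
        compact (closure {x. \<phi> x \<noteq> 0}) \<and> closure {x. \<phi> x \<noteq> 0} \<subseteq> D}"

section \<open>Lebesgue and Sobolev spaces\<close>

text \<open>Elements of function spaces over \<open>D\<close> are represented by functions on the whole space, of
  which only the restriction to \<open>D\<close>, up to null sets, matters.\<close>

definition L2 :: "'a::euclidean_space set \<Rightarrow> ('a \<Rightarrow> 'b::euclidean_space) set"
  where "L2 D = {f. f \<in> borel_measurable (lebesgue_on D) \<and>
                    integrable (lebesgue_on D) (\<lambda>x. (norm (f x))\<^sup>2)}"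

text \<open>The Bochner integral is used for the \<open>L\<^sup>1\<close> norm, so \<open>L1_norm\<close> is meaningful only for
  integrable functions; on bounded \<open>D\<close> this covers all of \<open>L2 D\<close>.\<close>

definition L1_norm :: "'a::euclidean_space set \<Rightarrow> ('a \<Rightarrow> real) \<Rightarrow> real"
  where "L1_norm D f = (\<integral>x. \<bar>f x\<bar> \<partial>lebesgue_on D)"

definition Linf_norm :: "'a::euclidean_space set \<Rightarrow> ('a \<Rightarrow> real) \<Rightarrow> ereal"
  where "Linf_norm D f = esssup (lebesgue_on D) (\<lambda>x. ereal \<bar>f x\<bar>)"

definition weak_gradient ::
    "'a::euclidean_space set \<Rightarrow> ('a \<Rightarrow> real) \<Rightarrow> ('a \<Rightarrow> 'a) \<Rightarrow> bool"
  where "weak_gradient D u g \<longleftrightarrow> u \<in> L2 D \<and> g \<in> L2 D \<and>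
    (\<forall>\<phi>\<in>test_functions D. \<forall>b\<in>Basis.
       (\<integral>x. u x * (gradient \<phi> x \<bullet> b) \<partial>lebesgue_on D) = - (\<integral>x. (g x \<bullet> b) * \<phi> x \<partial>lebesgue_on D))"

text \<open>\<open>H10 D\<close> is the closure of the test functions in the Sobolev space of square integrable
  functions with square integrable weak gradient.\<close>

definition H10 :: "'a::euclidean_space set \<Rightarrow> ('a \<Rightarrow> real) set"
  where "H10 D = {u. \<exists>g. weak_gradient D u g \<and>
    (\<exists>\<phi>. (\<forall>m::nat. \<phi> m \<in> test_functions D) \<and>
         (\<lambda>m. \<integral>x. (u x - \<phi> m x)\<^sup>2 + (norm (g x - gradient (\<phi> m) x))\<^sup>2 \<partial>lebesgue_on D)
           \<longlonglongrightarrow> 0)}"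

section \<open>The Dirichlet eigenvalue problem\<close>

text \<open>The equation \<open>-\<Delta> u = lam u\<close> is understood weakly, and the boundary condition is membership in
  \<open>H10 D\<close>. The weak gradient is unique up to null sets, so the choice of \<open>g\<close> is immaterial.\<close>

definition dirichlet_eigenpair ::
    "'a::euclidean_space set \<Rightarrow> real \<Rightarrow> ('a \<Rightarrow> real) \<Rightarrow> bool"
  where "dirichlet_eigenpair D lam u \<longleftrightarrow>
    u \<in> H10 D \<and> \<not> (AE x in lebesgue_on D. u x = 0) \<and>
    (\<exists>g. weak_gradient D u g \<and>
       (\<forall>\<phi>\<in>test_functions D.
          (\<integral>x. g x \<bullet> gradient \<phi> x \<partial>lebesgue_on D) = lam * (\<integral>x. u x * \<phi> x \<partial>lebesgue_on D)))"

end

theory Submission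
  imports Defs "HOL-Probability.Distributions"
begin

text \<open>The estimate follows from comparing \<open>\<bar>u\<bar>\<close> with the heat flow. Extended by zero, \<open>\<bar>u\<bar>\<close> satisfies
  \<open>- \<Delta>\<bar>u\<bar> \<le> lam \<cdot> \<bar>u\<bar>\<close> on the whole space in the sense of distributions (lemma \<open>kato\<close>). Hence
  \<open>exp (lam * t)\<close> times the average of \<open>\<bar>u\<bar>\<close> against the Gaussian heat kernel of time \<open>t\<close> centred at \<open>x\<close> is
  nondecreasing in \<open>t\<close> (lemma \<open>heat_average_mono\<close>). As \<open>t\<close> tends to zero these averages converge to
  \<open>\<bar>u\<bar>\<close> in the mean, and for every \<open>t\<close> the average is at most
  \<open>(4 * pi * t) powr (- n / 2)\<close> times the \<open>L\<^sup>1\<close> norm of \<open>u\<close>. Choosing \<open>t = n / (2 * lam)\<close> gives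

  \<open>\<bar>u x\<bar> \<le> A * L1_norm D u\<close> with \<open>A = (exp 1 * lam / (2 * pi * n)) powr (n / 2)\<close>

  almost everywhere (lemma \<open>eigenfunction_sup_bound\<close>).

  The constants in the theorem are at least \<open>A\<close>, but seeing this requires a lower bound for
  \<open>sqrt lam * R\<close>: for \<open>n > 2\<close> a term is subtracted, and for \<open>n = 2\<close> the term \<open>ln R\<close> may be
  negative. The bound is contained in the estimate itself. Integrated over \<open>D\<close> it says that
  \<open>A\<close> times the volume of \<open>D\<close> is at least one. What is left is arithmetic with the volume of the
  unit ball, which for \<open>n > 3\<close> is bounded by comparing the ball with a Gaussian.

  For Kato's inequality the eigenvalue equation is tested with \<open>\<zeta> \<cdot> \<psi> / sqrt (\<psi>\<^sup>2 + e\<^sup>2)\<close>, where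
  \<open>\<zeta> \<ge> 0\<close> is smooth on the whole space and \<open>\<psi>\<close> is a test function close to \<open>u\<close>. The
  product and chain rules are thus applied to smooth functions only.\<close>

section \<open>Smooth functions and test functions\<close>

abbreviation partial_deriv :: "'a::euclidean_space \<Rightarrow> ('a \<Rightarrow> real) \<Rightarrow> 'a \<Rightarrow> real"
  where "partial_deriv b f \<equiv> \<lambda>x. frechet_derivative f (at x) b"

definition smooth :: "('a::euclidean_space \<Rightarrow> real) \<Rightarrow> bool"
  where "smooth f \<longleftrightarrow> (\<forall>k. continuously_differentiable k f)"

lemma partial_deriv_eqI:
  assumes "\<And>x. (f has_derivative f' x) (at x)"
  shows "partial_deriv b f = (\<lambda>x. f' x b)"
  using frechet_derivative_at[OF assms] by (simp add: fun_eq_iff)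

lemma continuously_differentiable_SucI:
  assumes "\<And>x. (f has_derivative f' x) (at x)"
    and "\<And>b. b \<in> Basis \<Longrightarrow> continuously_differentiable k (\<lambda>x. f' x b)"
  shows "continuously_differentiable (Suc k) f"
  using assms by (auto simp: partial_deriv_eqI[OF assms(1)] differentiable_def)

lemma has_frechet_derivative:
  assumes "continuously_differentiable (Suc k) f"
  shows "(f has_derivative frechet_derivative f (at x)) (at x)"
  using assms frechet_derivative_works by auto

lemma continuously_differentiable_SucD:
  "continuously_differentiable (Suc k) f \<Longrightarrow> continuously_differentiable k f"
proof (induction k arbitrary: f)
  case 0
  then show ?case
    by (auto simp: continuous_on_eq_continuous_at intro: differentiable_imp_continuous_within)
next
  case (Suc k)
  then show ?case by auto
qed

lemma continuously_differentiable_const: "continuously_differentiable k (\<lambda>x. c)"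
proof (induction k arbitrary: c)
  case (Suc k)
  show ?case by (rule continuously_differentiable_SucI[where f'="\<lambda>_ _. 0"]) (auto intro: Suc)
qed simp

lemma continuously_differentiable_inner: "continuously_differentiable k (\<lambda>x. x \<bullet> c)"
proof (cases k)
  case (Suc k)
  show ?thesis unfolding Suc
    by (rule continuously_differentiable_SucI[where f'="\<lambda>_ h. h \<bullet> c"])
       (auto intro!: derivative_eq_intros continuously_differentiable_const)
qed (auto intro!: continuous_intros)

lemma continuously_differentiable_add:
  "continuously_differentiable k f \<Longrightarrow> continuously_differentiable k g \<Longrightarrow>
   continuously_differentiable k (\<lambda>x. f x + g x)"
proof (induction k arbitrary: f g)
  case (Suc k)
  show ?case
  proof (rule continuously_differentiable_SucI)
    show "((\<lambda>x. f x + g x) has_derivative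
        (\<lambda>h. frechet_derivative f (at x) h + frechet_derivative g (at x) h)) (at x)" for x
      using Suc.prems by (intro has_derivative_add has_frechet_derivative)
  qed (use Suc in auto)
qed (auto intro!: continuous_intros)

lemma continuously_differentiable_mult:
  "continuously_differentiable k f \<Longrightarrow> continuously_differentiable k g \<Longrightarrow>
   continuously_differentiable k (\<lambda>x. f x * g x)"
proof (induction k arbitrary: f g)
  case (Suc k)
  show ?case
  proof (rule continuously_differentiable_SucI)
    show "((\<lambda>x. f x * g x) has_derivative
        (\<lambda>h. f x * frechet_derivative g (at x) h + frechet_derivative f (at x) h * g x)) (at x)" for x
      using Suc.prems by (intro has_derivative_mult has_frechet_derivative)
  next
    fix b :: 'a assume "b \<in> Basis"
    then show "continuously_differentiable k
        (\<lambda>x. f x * frechet_derivative g (at x) b + frechet_derivative f (at x) b * g x)"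
      using Suc.prems continuously_differentiable_SucD[OF Suc.prems(1)]
        continuously_differentiable_SucD[OF Suc.prems(2)]
      by (auto intro!: continuously_differentiable_add Suc.IH)
  qed
qed (auto intro!: continuous_intros)

lemma continuously_differentiable_sum:
  "(\<And>i. i \<in> I \<Longrightarrow> continuously_differentiable k (f i)) \<Longrightarrow>
   continuously_differentiable k (\<lambda>x. \<Sum>i\<in>I. f i x)"
  by (induction I rule: infinite_finite_induct)
     (auto intro: continuously_differentiable_const continuously_differentiable_add)

lemma continuously_differentiable_exp:
  "continuously_differentiable k f \<Longrightarrow> continuously_differentiable k (\<lambda>x. exp (f x))"
proof (induction k arbitrary: f)
  case (Suc k)
  show ?case
  proof (rule continuously_differentiable_SucI)
    show "((\<lambda>x. exp (f x)) has_derivative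
        (\<lambda>h. frechet_derivative f (at x) h * exp (f x))) (at x)" for x
      using has_derivative_exp[OF has_frechet_derivative[OF Suc.prems]] .
  qed (use Suc continuously_differentiable_SucD[OF Suc.prems]
       in \<open>auto intro!: continuously_differentiable_mult\<close>)
qed (auto intro!: continuous_intros)

text \<open>The exponent is universally quantified in the induction because differentiating lowers it by
  one. This single lemma provides both \<open>sqrt (\<psi>\<^sup>2 + e\<^sup>2)\<close> and its reciprocal as smooth functions.\<close>

lemma continuously_differentiable_powr:
  "continuously_differentiable k f \<Longrightarrow> (\<And>x. f x > 0) \<Longrightarrow>
   continuously_differentiable k (\<lambda>x. f x powr a)"
proof (induction k arbitrary: f a)
  case (Suc k)
  show ?case
  proof (rule continuously_differentiable_SucI)
    show "((\<lambda>x. f x powr a) has_derivative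
        (\<lambda>h. a * (frechet_derivative f (at x) h * f x powr (a - 1)))) (at x)" for x
      by (rule has_derivative_eq_rhs, rule has_derivative_powr[OF
            has_frechet_derivative[OF Suc.prems(1)] has_derivative_const])
         (use Suc.prems(2)[of x] in \<open>auto simp: powr_diff field_simps\<close>)
  qed (use Suc continuously_differentiable_SucD[OF Suc.prems(1)]
       in \<open>auto intro!: continuously_differentiable_mult continuously_differentiable_const\<close>)
next
  case 0
  then show ?case
    by (auto intro!: continuous_intros) (metis less_irrefl)
qed

lemma smooth_intros:
  shows "smooth (\<lambda>x. c)" and "smooth (\<lambda>x. x \<bullet> a)"
    and "smooth f \<Longrightarrow> smooth g \<Longrightarrow> smooth (\<lambda>x. f x + g x)"
    and "smooth f \<Longrightarrow> smooth g \<Longrightarrow> smooth (\<lambda>x. f x * g x)"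
    and "(\<And>i. i \<in> I \<Longrightarrow> smooth (F i)) \<Longrightarrow> smooth (\<lambda>x. \<Sum>i\<in>I. F i x)"
    and "smooth f \<Longrightarrow> smooth (\<lambda>x. exp (f x))"
    and "smooth f \<Longrightarrow> (\<And>x. f x > 0) \<Longrightarrow> smooth (\<lambda>x. f x powr r)"
  unfolding smooth_def
  by (simp_all add: continuously_differentiable_const continuously_differentiable_inner
      continuously_differentiable_add continuously_differentiable_mult
      continuously_differentiable_sum continuously_differentiable_exp
      continuously_differentiable_powr)

lemma smooth_continuous: "smooth f \<Longrightarrow> continuous_on S f"
  unfolding smooth_def
  by (metis continuous_on_subset continuously_differentiable.simps(1) subset_UNIV)

lemma smooth_partial_deriv: "smooth f \<Longrightarrow> b \<in> Basis \<Longrightarrow> smooth (partial_deriv b f)"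
  unfolding smooth_def by (metis continuously_differentiable.simps(2))

lemma smooth_has_derivative: "smooth f \<Longrightarrow> (f has_derivative frechet_derivative f (at x)) (at x)"
  unfolding smooth_def using has_frechet_derivative by blast

lemma gradient_inner: "b \<in> Basis \<Longrightarrow> gradient f x \<bullet> b = frechet_derivative f (at x) b"
  by (simp add: gradient_def)

lemma gradient_inner_gradient:
  "gradient f x \<bullet> gradient g x =
     (\<Sum>b\<in>Basis. frechet_derivative f (at x) b * frechet_derivative g (at x) b)"
  by (subst euclidean_inner) (simp add: gradient_inner)

lemma smooth_gradient_continuous: "smooth f \<Longrightarrow> continuous_on S (gradient f)"
  unfolding gradient_def
  by (intro continuous_on_sum continuous_on_scaleR continuous_on_const smooth_continuous
      smooth_partial_deriv)

definition laplacian :: "('a::euclidean_space \<Rightarrow> real) \<Rightarrow> 'a \<Rightarrow> real"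
  where "laplacian f x = (\<Sum>b\<in>Basis. partial_deriv b (partial_deriv b f) x)"

lemma smooth_laplacian_continuous: "smooth f \<Longrightarrow> continuous_on S (laplacian f)"
  unfolding laplacian_def
  by (intro continuous_on_sum smooth_continuous smooth_partial_deriv)

lemma test_function_smooth: "\<phi> \<in> test_functions D \<Longrightarrow> smooth \<phi>"
  by (simp add: test_functions_def smooth_def)

text \<open>The support condition is inherited from another test function. Taking the closure on the right
  lets the lemma apply to derivatives, whose nonvanishing set need not lie inside that of the
  function itself.\<close>

lemma test_functionI:
  assumes "smooth f" and "\<phi> \<in> test_functions D" and "{x. f x \<noteq> 0} \<subseteq> closure {x. \<phi> x \<noteq> 0}"
  shows "f \<in> test_functions D"
proof -
  have "closure {x. f x \<noteq> 0} \<subseteq> closure {x. \<phi> x \<noteq> 0}"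
    using assms(3) closure_minimal by blast
  then show ?thesis
    using assms unfolding test_functions_def smooth_def
    by (auto simp: compact_eq_bounded_closed intro: bounded_subset)
qed

lemma partial_deriv_support:
  "{x. partial_deriv b f x \<noteq> 0} \<subseteq> closure {x. f x \<noteq> 0}"
proof (rule subsetI, rule ccontr)
  fix x assume x: "x \<in> {x. partial_deriv b f x \<noteq> 0}" and "x \<notin> closure {x. f x \<noteq> 0}"
  have "(f has_derivative (\<lambda>_. 0)) (at x)"
    by (rule has_derivative_transform_within_open[of "\<lambda>_. 0" _ x UNIV "- closure {x. f x \<noteq> 0}"])
       (use \<open>x \<notin> _\<close> closure_subset[of "{x. f x \<noteq> 0}"] in auto)
  then show False
    using x by (simp add: frechet_derivative_at[symmetric])
qed

lemma test_function_partial_deriv: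
  assumes "\<phi> \<in> test_functions D" and "b \<in> Basis"
  shows "partial_deriv b \<phi> \<in> test_functions D"
  using test_functionI[OF _ assms(1) partial_deriv_support]
    smooth_partial_deriv[OF test_function_smooth[OF assms(1)] assms(2)] by blast

lemma test_function_zero_outside: "\<phi> \<in> test_functions D \<Longrightarrow> x \<notin> D \<Longrightarrow> \<phi> x = 0"
  using closure_subset[of "{x. \<phi> x \<noteq> 0}"] by (auto simp: test_functions_def)

lemma test_function_times_smooth:
  "\<phi> \<in> test_functions D \<Longrightarrow> smooth f \<Longrightarrow> (\<lambda>x. \<phi> x * f x) \<in> test_functions D"
  by (rule test_functionI[of _ \<phi>])
     (use closure_subset[of "{x. \<phi> x \<noteq> 0}"] in \<open>auto intro: smooth_intros(4) test_function_smooth\<close>)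

section \<open>Integration over bounded domains\<close>

lemma continuous_bounded_on:
  fixes h :: "'a::euclidean_space \<Rightarrow> 'b::real_normed_vector"
  assumes "continuous_on UNIV h" and "bounded D"
  obtains C where "C \<ge> 0" and "\<And>x. x \<in> D \<Longrightarrow> norm (h x) \<le> C"
proof -
  have "bounded (h ` closure D)"
    using assms by (intro compact_imp_bounded compact_continuous_image)
      (auto intro: continuous_on_subset)
  then obtain C where "C > 0" "\<And>y. y \<in> h ` closure D \<Longrightarrow> norm y \<le> C"
    by (auto simp: bounded_pos)
  then show ?thesis
    using that[of C] closure_subset[of D] by auto
qed

lemma continuous_measurable_lebesgue_on:
  "continuous_on UNIV h \<Longrightarrow> D \<in> sets lebesgue \<Longrightarrow> h \<in> borel_measurable (lebesgue_on D)"
  by (meson continuous_imp_measurable_on_sets_lebesgue continuous_on_subset subset_UNIV)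

lemma continuous_integrable_lebesgue_on:
  fixes h :: "'a::euclidean_space \<Rightarrow> 'b::euclidean_space"
  assumes "continuous_on UNIV h" and "bounded D" and "D \<in> sets lebesgue"
  shows "integrable (lebesgue_on D) h"
proof -
  obtain C where C: "\<And>x. x \<in> D \<Longrightarrow> norm (h x) \<le> C"
    using continuous_bounded_on[OF assms(1,2)] by metis
  interpret finite_measure "lebesgue_on D"
    by (rule finite_measure_lebesgue_on) (rule bounded_set_imp_lmeasurable[OF assms(2,3)])
  show ?thesis
    by (rule integrable_const_bound[of _ C])
       (auto simp: C continuous_measurable_lebesgue_on assms)
qed

lemma continuous_L2:
  fixes h :: "'a::euclidean_space \<Rightarrow> 'b::euclidean_space"
  assumes "continuous_on UNIV h" and "bounded D" and "D \<in> sets lebesgue"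
  shows "h \<in> L2 D"
  unfolding L2_def
  using assms by (auto intro!: continuous_measurable_lebesgue_on continuous_integrable_lebesgue_on
      continuous_intros)

lemma L2_inner_integrable:
  assumes "f \<in> L2 D" and "g \<in> L2 D"
  shows "integrable (lebesgue_on D) (\<lambda>x. f x \<bullet> g x)"
proof (rule Bochner_Integration.integrable_bound)
  show "integrable (lebesgue_on D) (\<lambda>x. (norm (f x))\<^sup>2 + (norm (g x))\<^sup>2)"
    using assms by (auto simp: L2_def)
  show "(\<lambda>x. f x \<bullet> g x) \<in> borel_measurable (lebesgue_on D)"
    using assms by (auto simp: L2_def intro!: borel_measurable_inner)
  have "\<bar>f x \<bullet> g x\<bar> \<le> (norm (f x))\<^sup>2 + (norm (g x))\<^sup>2" for x
    using Cauchy_Schwarz_ineq2[of "f x" "g x"] sum_squares_bound[of "norm (f x)" "norm (g x)"]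
      mult_nonneg_nonneg[of "norm (f x)" "norm (g x)"] by linarith
  then show "AE x in lebesgue_on D. norm (f x \<bullet> g x) \<le> norm ((norm (f x))\<^sup>2 + (norm (g x))\<^sup>2)"
    by auto
qed

lemma L2_mult_integrable:
  fixes f g :: "_ \<Rightarrow> real"
  shows "f \<in> L2 D \<Longrightarrow> g \<in> L2 D \<Longrightarrow> integrable (lebesgue_on D) (\<lambda>x. f x * g x)"
  using L2_inner_integrable[of f D g] by simp

lemma L2_component: "g \<in> L2 D \<Longrightarrow> b \<in> Basis \<Longrightarrow> (\<lambda>x. g x \<bullet> b) \<in> L2 D"
proof -
  assume g: "g \<in> L2 D" and b: "b \<in> Basis"
  then have [measurable]: "g \<in> borel_measurable (lebesgue_on D)" by (simp add: L2_def)
  have "integrable (lebesgue_on D) (\<lambda>x. (norm (g x \<bullet> b))\<^sup>2)"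
  proof (rule Bochner_Integration.integrable_bound)
    show "integrable (lebesgue_on D) (\<lambda>x. (norm (g x))\<^sup>2)" using g by (auto simp: L2_def)
    show "AE x in lebesgue_on D. norm ((norm (g x \<bullet> b))\<^sup>2) \<le> norm ((norm (g x))\<^sup>2)"
    proof (rule AE_I2)
      fix x
      have "(norm (g x \<bullet> b))\<^sup>2 \<le> (norm (g x))\<^sup>2"
        using b by (intro power_mono) (auto simp: Basis_le_norm)
      then show "norm ((norm (g x \<bullet> b))\<^sup>2) \<le> norm ((norm (g x))\<^sup>2)"
        by simp
    qed
  qed measurable
  then show ?thesis by (simp add: L2_def)
qed

lemma L2_diff_integrable:
  assumes "f \<in> L2 D" and "g \<in> L2 D"
  shows "integrable (lebesgue_on D) (\<lambda>x. (norm (f x - g x))\<^sup>2)"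
proof -
  have "integrable (lebesgue_on D)
      (\<lambda>x. (norm (f x))\<^sup>2 + (norm (g x))\<^sup>2 - 2 * (f x \<bullet> g x))"
    using assms L2_inner_integrable[OF assms] by (auto simp: L2_def)
  then show ?thesis
    by (simp add: power2_norm_eq_inner inner_diff_left inner_diff_right inner_commute algebra_simps)
qed

lemma L2_integrable:
  fixes f :: "'a::euclidean_space \<Rightarrow> real"
  assumes "f \<in> L2 D" and "bounded D" and "D \<in> sets lebesgue"
  shows "integrable (lebesgue_on D) f"
  using L2_mult_integrable[OF assms(1) continuous_L2[of "\<lambda>_. 1"]] assms(2,3) by simp

text \<open>The integral of a difference quotient \<open>(\<phi> (x + h *\<^sub>R b) - \<phi> x) / h\<close> over the whole space is zero
  because Lebesgue measure is translation invariant. The quotients converge to the partial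
  derivative, and by the mean value theorem they are bounded uniformly and live on a common ball, so
  dominated convergence passes to the limit.\<close>

lemma integral_partial_deriv_test_function:
  assumes "\<phi> \<in> test_functions D" and "b \<in> Basis" and "D \<in> sets lebesgue"
  shows "(\<integral>x. partial_deriv b \<phi> x \<partial>lebesgue_on D) = 0"
proof -
  note sm = test_function_smooth[OF assms(1)]
  let ?\<phi>' = "partial_deriv b \<phi>"
  have b: "norm b = 1" using assms(2) by simp
  have cont: "continuous_on UNIV \<phi>" "continuous_on UNIV ?\<phi>'"
    using sm assms(2) by (auto intro: smooth_continuous smooth_partial_deriv)
  then have meas [measurable]: "\<phi> \<in> borel_measurable borel" "?\<phi>' \<in> borel_measurable borel"
    by (auto intro: borel_measurable_continuous_onI)
  have test': "?\<phi>' \<in> test_functions D"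
    using assms by (intro test_function_partial_deriv)
  have "bounded (closure {x. \<phi> x \<noteq> 0})"
    using assms(1) by (simp add: test_functions_def compact_imp_bounded)
  then obtain r where r: "\<And>x. x \<in> closure {x. \<phi> x \<noteq> 0} \<Longrightarrow> norm x \<le> r"
    unfolding bounded_iff by auto
  have zero: "\<phi> x = 0" "?\<phi>' x = 0" if "norm x > r" for x
  proof -
    have "x \<notin> closure {x. \<phi> x \<noteq> 0}"
      using r[of x] that by auto
    then show "\<phi> x = 0" "?\<phi>' x = 0"
      using partial_deriv_support[where b=b and f=\<phi>] closure_subset[of "{x. \<phi> x \<noteq> 0}"]
      by blast+
  qed
  obtain C where C: "C \<ge> 0" "\<And>x. x \<in> cball 0 r \<Longrightarrow> norm (?\<phi>' x) \<le> C"
    using continuous_bounded_on[OF cont(2), of "cball 0 r"] by auto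
  have C': "\<bar>?\<phi>' x\<bar> \<le> C" for x
    using C zero(2)[of x] by (cases "norm x \<le> r") auto
  have line: "((\<lambda>s. \<phi> (x + s *\<^sub>R b)) has_real_derivative ?\<phi>' (x + s *\<^sub>R b)) (at s)" for x s
  proof -
    have "(\<phi> \<circ> (\<lambda>s. x + s *\<^sub>R b) has_derivative
        frechet_derivative \<phi> (at (x + s *\<^sub>R b)) \<circ> (\<lambda>h. h *\<^sub>R b)) (at s)"
      by (rule diff_chain_at[OF _ smooth_has_derivative[OF sm]]) (auto intro!: derivative_eq_intros)
    then show ?thesis
      using linear_scale[OF has_derivative_linear[OF smooth_has_derivative[OF sm]]]
      by (simp add: has_field_derivative_def o_def mult_commute_abs)
  qed
  \<comment> \<open>Steps of length at most one keep all difference quotients on the ball of radius \<open>r + 1\<close>.\<close>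
  define h where "h k = inverse (real (Suc k))" for k
  have h: "0 < h k" "h k \<le> 1" for k
    by (auto simp: h_def inverse_le_1_iff)
  have hlim: "h \<longlonglongrightarrow> 0"
    unfolding h_def by (rule LIMSEQ_inverse_real_of_nat)
  define q where "q k x = (\<phi> (x + h k *\<^sub>R b) - \<phi> x) / h k" for k x
  have q_int: "(\<integral>x. q k x \<partial>lborel) = 0" for k
  proof -
    have int: "integrable lborel \<phi>"
    proof (rule Bochner_Integration.integrable_cong[THEN iffD1, OF refl])
      show "integrable lborel (\<lambda>x. indicator (cball 0 r) x *\<^sub>R \<phi> x)"
        using cont(1) by (intro borel_integrable_compact) (auto intro: continuous_on_subset)
      show "indicator (cball 0 r) x *\<^sub>R \<phi> x = \<phi> x" for x
        using zero(1)[of x] by (auto simp: indicator_def not_le)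
    qed
    have "integrable (distr lborel borel ((+) (h k *\<^sub>R b))) \<phi>"
      using int by (simp add: lborel_distr_plus)
    then have int': "integrable lborel (\<lambda>x. \<phi> (h k *\<^sub>R b + x))"
      by (rule integrable_distr[rotated]) simp
    have "(\<integral>x. \<phi> (h k *\<^sub>R b + x) \<partial>lborel) = (\<integral>x. \<phi> x \<partial>distr lborel borel ((+) (h k *\<^sub>R b)))"
      by (rule integral_distr[symmetric]) auto
    also have "\<dots> = (\<integral>x. \<phi> x \<partial>lborel)"
      by (simp add: lborel_distr_plus)
    finally show ?thesis
      unfolding q_def using int int' by (simp add: add.commute)
  qed
  have "(\<lambda>k. \<integral>x. q k x \<partial>lborel) \<longlonglongrightarrow> (\<integral>x. ?\<phi>' x \<partial>lborel)"
  proof (rule integral_dominated_convergence)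
    show "integrable lborel (\<lambda>x. C * indicator (cball (0::'a) (r + 1)) x)"
      using emeasure_lborel_cball_finite[of "0::'a" "r + 1"]
      by (intro integrable_mult_right integrable_real_indicator) auto
    show "AE x in lborel. (\<lambda>k. q k x) \<longlonglongrightarrow> ?\<phi>' x"
    proof (rule AE_I2)
      fix x
      have "((\<lambda>s. (\<phi> (x + s *\<^sub>R b) - \<phi> x) / s) \<longlongrightarrow> ?\<phi>' x) (at 0)"
        using line[of x 0] by (simp add: DERIV_def)
      moreover have "h k \<noteq> 0" for k
        using h(1)[of k] by simp
      then have "filterlim h (at 0) sequentially"
        using hlim by (simp add: filterlim_at)
      ultimately show "(\<lambda>k. q k x) \<longlonglongrightarrow> ?\<phi>' x"
        unfolding q_def by (rule filterlim_compose)
    qed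
    show "AE x in lborel. norm (q k x) \<le> C * indicator (cball 0 (r + 1)) x" for k
    proof (rule AE_I2)
      fix x
      show "norm (q k x) \<le> C * indicator (cball 0 (r + 1)) x"
      proof (cases "norm x \<le> r + 1")
        case True
        obtain z where "\<phi> (x + h k *\<^sub>R b) - \<phi> (x + 0 *\<^sub>R b) = (h k - 0) * ?\<phi>' (x + z *\<^sub>R b)"
          using MVT2[of 0 "h k" "\<lambda>s. \<phi> (x + s *\<^sub>R b)" "\<lambda>s. ?\<phi>' (x + s *\<^sub>R b)"] line h by auto
        then have "q k x = ?\<phi>' (x + z *\<^sub>R b)"
          using h(1)[of k] by (simp add: q_def)
        then show ?thesis using C' True by simp
      next
        case False
        have "norm x - norm (h k *\<^sub>R b) \<le> norm (x + h k *\<^sub>R b)"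
          by (rule norm_diff_ineq)
        then have "norm (x + h k *\<^sub>R b) > r"
          using False h[of k] b by simp
        then show ?thesis
          using zero(1)[of "x + h k *\<^sub>R b"] zero(1)[of x] False by (simp add: q_def)
      qed
    qed
  qed (auto simp: q_def)
  then have "(\<integral>x. ?\<phi>' x \<partial>lborel) = 0"
    by (simp add: q_int LIMSEQ_const_iff)
  moreover have "(\<integral>x. ?\<phi>' x \<partial>lebesgue_on D) = (\<integral>x. (if x \<in> D then ?\<phi>' x else 0) \<partial>lebesgue)"
    by (rule Lebesgue_Measure.integral_restrict_UNIV[OF assms(3), symmetric])
  moreover have "(\<lambda>x. if x \<in> D then ?\<phi>' x else 0) = ?\<phi>'"
    using test_function_zero_outside[OF test'] by auto
  ultimately show ?thesis
    by (simp add: integral_completion)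
qed

lemma partial_deriv_mult:
  assumes "smooth f" and "smooth g"
  shows "partial_deriv b (\<lambda>x. f x * g x) x = f x * partial_deriv b g x + partial_deriv b f x * g x"
  using partial_deriv_eqI[OF has_derivative_mult[OF smooth_has_derivative[OF assms(1)]
      smooth_has_derivative[OF assms(2)]]] by (simp add: fun_eq_iff)

lemma partial_deriv_compose:
  assumes "smooth f" and "\<And>s. (F has_real_derivative F' s) (at s)"
  shows "partial_deriv b (\<lambda>x. F (f x)) x = F' (f x) * partial_deriv b f x"
proof -
  have "((\<lambda>x. F (f x)) has_derivative (\<lambda>h. F' (f x) * frechet_derivative f (at x) h)) (at x)" for x
    using diff_chain_at[OF smooth_has_derivative[OF assms(1)]
        assms(2)[unfolded has_field_derivative_def]] by (simp add: o_def)
  from fun_cong[OF partial_deriv_eqI[OF this]] show ?thesis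
    by simp
qed

lemma gradient_eqI:
  assumes "\<And>b. b \<in> Basis \<Longrightarrow> partial_deriv b f x = v \<bullet> b"
  shows "gradient f x = v"
  using assms by (simp add: gradient_def euclidean_representation)

text \<open>The integrand is the divergence of \<open>\<eta> \<cdot> \<nabla>\<zeta>\<close>, a field whose components are test functions.\<close>

lemma green_test_function:
  assumes "\<eta> \<in> test_functions D" and "smooth \<zeta>" and "bounded D" and "D \<in> sets lebesgue"
  shows "(\<integral>x. gradient \<eta> x \<bullet> gradient \<zeta> x + \<eta> x * laplacian \<zeta> x \<partial>lebesgue_on D) = 0"
proof -
  let ?P = "\<lambda>b x. \<eta> x * partial_deriv b \<zeta> x"
  have test: "?P b \<in> test_functions D" if "b \<in> Basis" for b
    using assms that by (intro test_function_times_smooth smooth_partial_deriv)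
  have "gradient \<eta> x \<bullet> gradient \<zeta> x + \<eta> x * laplacian \<zeta> x = (\<Sum>b\<in>Basis. partial_deriv b (?P b) x)" for x
    using test_function_smooth[OF assms(1)] assms(2)
    by (simp add: gradient_inner_gradient laplacian_def partial_deriv_mult smooth_partial_deriv
        sum_distrib_left sum.distrib)
  moreover have "integrable (lebesgue_on D) (partial_deriv b (?P b))" if "b \<in> Basis" for b
    using that test assms(3,4)
    by (intro continuous_integrable_lebesgue_on smooth_continuous smooth_partial_deriv)
       (auto intro: test_function_smooth)
  ultimately show ?thesis
    using test assms(4) by (simp add: integral_partial_deriv_test_function)
qed

text \<open>A weak gradient may be paired with \<open>\<nabla>\<phi>\<close> because the partial derivatives of a test function are
  test functions again. As the right-hand side does not mention \<open>g\<close>, all weak gradients of \<open>u\<close> give the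
  same pairing. The gradient in the eigenvalue equation can thus be exchanged for the one
  approximated in \<open>H10 D\<close>, with no appeal to uniqueness.\<close>

lemma weak_gradient_laplacian:
  assumes "weak_gradient D u g" and "\<phi> \<in> test_functions D" and "bounded D" and "D \<in> sets lebesgue"
  shows "(\<integral>x. g x \<bullet> gradient \<phi> x \<partial>lebesgue_on D) = - (\<integral>x. u x * laplacian \<phi> x \<partial>lebesgue_on D)"
proof -
  note sm = test_function_smooth[OF assms(2)]
  have u: "u \<in> L2 D" and g: "g \<in> L2 D"
    using assms(1) by (auto simp: weak_gradient_def)
  have cL2: "partial_deriv b \<phi> \<in> L2 D" "partial_deriv b (partial_deriv b \<phi>) \<in> L2 D" if "b \<in> Basis" for b
    using that sm assms(3,4) by (auto intro!: continuous_L2 smooth_continuous smooth_partial_deriv)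
  have "(\<integral>x. g x \<bullet> gradient \<phi> x \<partial>lebesgue_on D)
      = (\<integral>x. (\<Sum>b\<in>Basis. (g x \<bullet> b) * partial_deriv b \<phi> x) \<partial>lebesgue_on D)"
    by (intro Bochner_Integration.integral_cong refl, subst euclidean_inner)
       (simp add: gradient_inner)
  also have "\<dots> = (\<Sum>b\<in>Basis. \<integral>x. (g x \<bullet> b) * partial_deriv b \<phi> x \<partial>lebesgue_on D)"
    by (intro Bochner_Integration.integral_sum L2_mult_integrable L2_component g cL2)
  also have "\<dots> = (\<Sum>b\<in>Basis. - (\<integral>x. u x * partial_deriv b (partial_deriv b \<phi>) x \<partial>lebesgue_on D))"
  proof (rule sum.cong[OF refl])
    fix b :: 'a assume b: "b \<in> Basis"
    have "(\<integral>x. u x * (gradient (partial_deriv b \<phi>) x \<bullet> b) \<partial>lebesgue_on D)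
        = - (\<integral>x. (g x \<bullet> b) * partial_deriv b \<phi> x \<partial>lebesgue_on D)"
      using assms(1,2) b test_function_partial_deriv unfolding weak_gradient_def by blast
    then show "(\<integral>x. (g x \<bullet> b) * partial_deriv b \<phi> x \<partial>lebesgue_on D)
        = - (\<integral>x. u x * partial_deriv b (partial_deriv b \<phi>) x \<partial>lebesgue_on D)"
      using b by (simp add: gradient_inner)
  qed
  also have "\<dots> = - (\<integral>x. (\<Sum>b\<in>Basis. u x * partial_deriv b (partial_deriv b \<phi>) x) \<partial>lebesgue_on D)"
    by (subst Bochner_Integration.integral_sum)
       (auto intro!: L2_mult_integrable u cL2 simp: sum_negf)
  finally show ?thesis
    by (simp add: laplacian_def sum_distrib_left)
qed

section \<open>Kato's inequality\<close>

text \<open>Here \<open>S - e\<close> is a smooth convex approximation of \<open>\<bar>s\<bar>\<close> that vanishes at \<open>0\<close>, with first derivative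
  \<open>s / S\<close> and second derivative \<open>e\<^sup>2 / S ^ 3\<close>. Vanishing at \<open>0\<close> is what keeps compact supports.\<close>

lemma smoothed_abs_bounds:
  fixes e s :: real
  assumes e: "e > 0"
  defines "S \<equiv> sqrt (s\<^sup>2 + e\<^sup>2)"
  shows "S > 0" and "\<bar>s / S\<bar> \<le> 1" and "0 \<le> e\<^sup>2 / S ^ 3" and "e\<^sup>2 / S ^ 3 \<le> 1 / e"
    and "\<bar>\<bar>s\<bar> - (S - e)\<bar> \<le> e" and "\<bar>\<bar>s\<bar> - s * (s / S)\<bar> \<le> e"
proof -
  have Ss: "S \<ge> \<bar>s\<bar>" and Se: "S \<ge> e" and Sse: "S \<le> \<bar>s\<bar> + e"
    using e sqrt_sum_squares_le_sum_abs[of s e]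
    unfolding S_def by (auto intro!: real_le_rsqrt)
  show S: "S > 0" using Se e by linarith
  show "\<bar>s / S\<bar> \<le> 1" using Ss S by simp
  show "0 \<le> e\<^sup>2 / S ^ 3" using S by simp
  have "e\<^sup>2 / S ^ 3 \<le> e\<^sup>2 / e ^ 3"
    using Se S e by (intro divide_left_mono power_mono) auto
  then show "e\<^sup>2 / S ^ 3 \<le> 1 / e"
    using e by (simp add: power2_eq_square power3_eq_cube)
  show "\<bar>\<bar>s\<bar> - (S - e)\<bar> \<le> e" using Ss Sse by linarith
  have "\<bar>s\<bar> * S - s\<^sup>2 = \<bar>s\<bar> * (S - \<bar>s\<bar>)" 
    by (simp add: right_diff_distrib power2_eq_square)
  moreover have "\<bar>s\<bar> * (S - \<bar>s\<bar>) \<le> S * e" "0 \<le> \<bar>s\<bar> * (S - \<bar>s\<bar>)"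
    using Ss Sse S by (auto intro!: mult_mono)
  moreover have "\<bar>s\<bar> - s * (s / S) = (\<bar>s\<bar> * S - s\<^sup>2) / S"
    using S by (simp add: field_simps power2_eq_square)
  ultimately show "\<bar>\<bar>s\<bar> - s * (s / S)\<bar> \<le> e"
    using S by (simp add: field_simps)
qed

text \<open>The first bracket is the integrand of the eigenvalue equation tested with \<open>\<zeta> \<cdot> \<psi> / S\<close>, the second
  that of Green's formula for \<open>S - e\<close> and \<open>\<zeta>\<close>; here \<open>s\<close>, \<open>\<Psi>\<close> are the value and gradient of \<open>\<psi>\<close>, and
  \<open>z\<close>, \<open>Z\<close>, \<open>L\<close> the value, gradient and Laplacian of \<open>\<zeta>\<close>. The two terms \<open>(s / S) *\<^sub>R \<Psi> \<bullet> Z\<close> cancel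
  up to \<open>G - \<Psi>\<close>, and what convexity contributes, \<open>G \<bullet> \<Psi>\<close> with a nonnegative factor, is
  nonnegative up to \<open>norm (G - \<Psi>)\<close> squared. Every error is therefore controlled by \<open>e\<close> and the
  squared distances, which are what convergence in \<open>H10 D\<close> makes small.\<close>

lemma kato_pointwise:
  fixes G \<Psi> Z :: "'a::real_inner" and lam e C u s z L :: real
  assumes e: "e > 0" and z: "0 \<le> z" "z \<le> C" and Z: "norm Z \<le> C" and L: "\<bar>L\<bar> \<le> C"
  defines "S \<equiv> sqrt (s\<^sup>2 + e\<^sup>2)"
  shows "(G \<bullet> ((s / S) *\<^sub>R Z + (z * (e\<^sup>2 / S ^ 3)) *\<^sub>R \<Psi>) - lam * (u * (s * (z / S))))
      - (((s / S) *\<^sub>R \<Psi>) \<bullet> Z + (S - e) * L)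
    \<ge> - (\<bar>u\<bar> * (L + lam * z)) - C * (4 + 3 * \<bar>lam\<bar>) * (e + ((u - s)\<^sup>2 + (norm (G - \<Psi>))\<^sup>2) / e)"
proof -
  note bnd = smoothed_abs_bounds[OF e, of s, folded S_def]
  define \<beta> where "\<beta> = s / S"
  define \<beta>' where "\<beta>' = e\<^sup>2 / S ^ 3"
  define d where "d = norm (G - \<Psi>)"
  define r where "r = u - s"
  have d0: "d \<ge> 0" and C0: "C \<ge> 0" using z by (auto simp: d_def)
  have young: "\<bar>x\<bar> \<le> e + x\<^sup>2 / e" for x :: real
  proof -
    have "2 * (\<bar>x\<bar> * e) \<le> e\<^sup>2 + x\<^sup>2"
      using sum_squares_bound[of e "\<bar>x\<bar>"] by (simp add: algebra_simps)
    moreover have "0 \<le> \<bar>x\<bar> * e" using e by simp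
    ultimately have "\<bar>x\<bar> * e \<le> e\<^sup>2 + x\<^sup>2" by linarith
    then show ?thesis using e by (simp add: field_simps power2_eq_square)
  qed
  have eq: "(G \<bullet> (\<beta> *\<^sub>R Z + (z * \<beta>') *\<^sub>R \<Psi>) - lam * (u * (s * (z / S))))
      - ((\<beta> *\<^sub>R \<Psi>) \<bullet> Z + (S - e) * L)
    = \<beta> * ((G - \<Psi>) \<bullet> Z) + z * \<beta>' * (G \<bullet> \<Psi>) - lam * z * (u * \<beta>) - (S - e) * L"
    by (simp add: \<beta>_def inner_add_right inner_diff_left algebra_simps)
  have 1: "\<beta> * ((G - \<Psi>) \<bullet> Z) \<ge> - (C * d)"
  proof -
    have "\<bar>\<beta> * ((G - \<Psi>) \<bullet> Z)\<bar> \<le> 1 * (d * C)"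
      unfolding abs_mult d_def
      by (intro mult_mono order_trans[OF Cauchy_Schwarz_ineq2] bnd(2)[folded \<beta>_def] mult_left_mono Z)
         auto
    then show ?thesis by (simp add: mult.commute)
  qed
  \<comment> \<open>Completing the square avoids any bound on the gradient of the approximants.\<close>
  have 2: "z * \<beta>' * (G \<bullet> \<Psi>) \<ge> - (C * (d\<^sup>2 / e))"
  proof -
    have "G \<bullet> \<Psi> = (norm (\<Psi> + (1/2) *\<^sub>R (G - \<Psi>)))\<^sup>2 - d\<^sup>2 / 4"
      by (simp add: d_def power2_norm_eq_inner inner_add_left inner_add_right inner_diff_left
          inner_diff_right inner_commute field_simps)
    then have "G \<bullet> \<Psi> \<ge> - d\<^sup>2"
      using zero_le_power2[of d] zero_le_power2[of "norm (\<Psi> + (1/2) *\<^sub>R (G - \<Psi>))"] by linarith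
    then have "z * \<beta>' * (G \<bullet> \<Psi>) \<ge> z * \<beta>' * (- d\<^sup>2)"
      using mult_nonneg_nonneg[OF z(1) bnd(3)] by (intro mult_left_mono) (auto simp: \<beta>'_def)
    moreover have "z * \<beta>' * d\<^sup>2 \<le> C * (1 / e) * d\<^sup>2"
      using z bnd(3,4) e by (intro mult_right_mono mult_mono) (auto simp: \<beta>'_def)
    ultimately show ?thesis by simp
  qed
  have 3: "\<bar>\<bar>u\<bar> - u * \<beta>\<bar> \<le> 2 * \<bar>r\<bar> + e"
  proof -
    have "\<bar>(s - u) * \<beta>\<bar> \<le> \<bar>r\<bar> * 1"
      unfolding abs_mult r_def using bnd(2)[folded \<beta>_def] by (intro mult_mono) auto
    then have t3: "\<bar>(s - u) * \<beta>\<bar> \<le> \<bar>r\<bar>" by simp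
    have t1: "\<bar>\<bar>u\<bar> - \<bar>s\<bar>\<bar> \<le> \<bar>r\<bar>"
      unfolding r_def by (rule abs_triangle_ineq3)
    have "\<bar>u\<bar> - u * \<beta> = (\<bar>u\<bar> - \<bar>s\<bar>) + (\<bar>s\<bar> - s * \<beta>) + (s - u) * \<beta>"
      by (simp add: algebra_simps)
    also have "\<bar>\<dots>\<bar> \<le> \<bar>\<bar>u\<bar> - \<bar>s\<bar>\<bar> + \<bar>\<bar>s\<bar> - s * \<beta>\<bar> + \<bar>(s - u) * \<beta>\<bar>"
      by (intro order_trans[OF abs_triangle_ineq] add_mono order_refl)
    also have "\<dots> \<le> \<bar>r\<bar> + e + \<bar>r\<bar>"
      by (intro add_mono t1 t3 bnd(6)[folded \<beta>_def])
    finally show ?thesis by simp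
  qed
  have 4: "lam * z * (u * \<beta>) \<le> lam * z * \<bar>u\<bar> + \<bar>lam\<bar> * C * (2 * \<bar>r\<bar> + e)"
  proof -
    have "\<bar>lam * z * (\<bar>u\<bar> - u * \<beta>)\<bar> \<le> \<bar>lam\<bar> * C * (2 * \<bar>r\<bar> + e)"
      unfolding abs_mult using z 3 by (intro mult_mono) auto
    then have "lam * z * (u * \<beta> - \<bar>u\<bar>) \<le> \<bar>lam\<bar> * C * (2 * \<bar>r\<bar> + e)"
      using abs_le_D2 by (fastforce simp: algebra_simps)
    then show ?thesis by (simp add: algebra_simps)
  qed
  have 5: "(S - e) * L \<le> \<bar>u\<bar> * L + C * (e + \<bar>r\<bar>)"
  proof -
    have "(S - e) - \<bar>u\<bar> = - (\<bar>s\<bar> - (S - e)) + (\<bar>s\<bar> - \<bar>u\<bar>)" by simp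
    also have "\<bar>\<dots>\<bar> \<le> \<bar>- (\<bar>s\<bar> - (S - e))\<bar> + \<bar>\<bar>s\<bar> - \<bar>u\<bar>\<bar>"
      by (rule abs_triangle_ineq)
    also have "\<dots> \<le> e + \<bar>r\<bar>"
      unfolding abs_minus_cancel r_def abs_minus_commute[of u]
      by (intro add_mono bnd(5) abs_triangle_ineq3)
    finally have "\<bar>((S - e) - \<bar>u\<bar>) * L\<bar> \<le> (e + \<bar>r\<bar>) * C"
      unfolding abs_mult using L e by (intro mult_mono) auto
    then have "((S - e) - \<bar>u\<bar>) * L \<le> (e + \<bar>r\<bar>) * C" by (rule abs_le_D1)
    then show ?thesis by (simp add: algebra_simps)
  qed
  let ?E = "e + (r\<^sup>2 + d\<^sup>2) / e"
  have E: "\<bar>r\<bar> \<le> ?E" "d \<le> ?E" "e \<le> ?E" "d\<^sup>2 / e \<le> ?E"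
  proof -
    have E': "?E = e + r\<^sup>2 / e + d\<^sup>2 / e" by (simp add: add_divide_distrib)
    have "0 \<le> r\<^sup>2 / e" "0 \<le> d\<^sup>2 / e" using e by auto
    moreover have "d \<le> e + d\<^sup>2 / e" using young[of d] d0 by simp
    ultimately show "\<bar>r\<bar> \<le> ?E" "d \<le> ?E" "e \<le> ?E" "d\<^sup>2 / e \<le> ?E"
      unfolding E' using young[of r] e by linarith+
  qed
  have rE: "e + \<bar>r\<bar> \<le> 2 * ?E" "2 * \<bar>r\<bar> + e \<le> 3 * ?E" "d + d\<^sup>2 / e \<le> 2 * ?E"
  proof -
    have two: "a + b \<le> 2 * t" and three: "2 * a + b \<le> 3 * t" if "a \<le> t" "b \<le> t" for a b t :: real
      using that by linarith+
    show "e + \<bar>r\<bar> \<le> 2 * ?E" "2 * \<bar>r\<bar> + e \<le> 3 * ?E" "d + d\<^sup>2 / e \<le> 2 * ?E"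
      by (rule two[OF E(3,1)], rule three[OF E(1,3)], rule two[OF E(2,4)])
  qed
  \<comment> \<open>The constant in the statement just adds up these coefficients.\<close>
  have "C * (d + d\<^sup>2 / e) + \<bar>lam\<bar> * C * (2 * \<bar>r\<bar> + e) + C * (e + \<bar>r\<bar>)
      \<le> C * (2 * ?E) + \<bar>lam\<bar> * C * (3 * ?E) + C * (2 * ?E)"
    using C0 by (intro add_mono mult_left_mono rE) auto
  also have "\<dots> = C * (4 + 3 * \<bar>lam\<bar>) * ?E"
    by (simp add: algebra_simps)
  finally have 6: "C * d + C * (d\<^sup>2 / e) + \<bar>lam\<bar> * C * (2 * \<bar>r\<bar> + e) + C * (e + \<bar>r\<bar>)
      \<le> C * (4 + 3 * \<bar>lam\<bar>) * ?E"
    by (simp only: distrib_left)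
  have 7: "\<bar>u\<bar> * (L + lam * z) = \<bar>u\<bar> * L + lam * z * \<bar>u\<bar>"
    by (simp add: algebra_simps)
  have "- (a + b) - k \<le> p + q - v - w"
    if "p \<ge> - x1" "q \<ge> - x2" "v \<le> b + x3" "w \<le> a + x4" "x1 + x2 + x3 + x4 \<le> k"
    for a b k p q v w x1 x2 x3 x4 :: real
    using that by linarith
  from this[OF 1 2 4 5 6] show ?thesis
    unfolding \<beta>_def[symmetric] \<beta>'_def[symmetric] eq d_def[symmetric] r_def[symmetric] 7 .
qed

text \<open>The modulus of an eigenfunction is a subsolution of its own equation, on the whole space and not
  only in \<open>D\<close>: the function \<open>\<zeta>\<close> may be nonzero on the boundary, since the test function
  \<open>\<zeta> \<cdot> \<psi> / S\<close> inherits its support from \<open>\<psi>\<close>. Integrating the pointwise inequality for the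
  approximating test functions \<open>\<psi> m\<close> and letting first \<open>m\<close> tend to infinity and then \<open>e\<close> to zero
  gives the claim. The order matters, because the error contains \<open>err m / e\<close>.\<close>

lemma kato:
  fixes u \<zeta> :: "'a::euclidean_space \<Rightarrow> real"
  assumes "open D" and "bounded D" and "dirichlet_eigenpair D lam u"
    and \<zeta>: "smooth \<zeta>" "\<And>x. \<zeta> x \<ge> 0"
  shows "(\<integral>x. \<bar>u x\<bar> * (laplacian \<zeta> x + lam * \<zeta> x) \<partial>lebesgue_on D) \<ge> 0"
proof -
  have D: "D \<in> sets lebesgue" using assms(1) by auto
  obtain g \<psi> where g: "weak_gradient D u g" and \<psi>: "\<And>m::nat. \<psi> m \<in> test_functions D"
    and lim: "(\<lambda>m. \<integral>x. (u x - \<psi> m x)\<^sup>2 + (norm (g x - gradient (\<psi> m) x))\<^sup>2 \<partial>lebesgue_on D) \<longlonglongrightarrow> 0"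
    using assms(3) unfolding dirichlet_eigenpair_def H10_def by blast
  obtain g' where g': "weak_gradient D u g'"
    and weak': "\<And>\<phi>. \<phi> \<in> test_functions D \<Longrightarrow> (\<integral>x. g' x \<bullet> gradient \<phi> x \<partial>lebesgue_on D)
        = lam * (\<integral>x. u x * \<phi> x \<partial>lebesgue_on D)"
    using assms(3) unfolding dirichlet_eigenpair_def by blast
  have uL2: "u \<in> L2 D" and gL2: "g \<in> L2 D"
    using g by (auto simp: weak_gradient_def)
  have u_int: "integrable (lebesgue_on D) u"
    by (rule L2_integrable[OF uL2 assms(2) D])
  have weak: "(\<integral>x. g x \<bullet> gradient \<phi> x \<partial>lebesgue_on D) = lam * (\<integral>x. u x * \<phi> x \<partial>lebesgue_on D)"
    if "\<phi> \<in> test_functions D" for \<phi>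
    using weak'[OF that] weak_gradient_laplacian[OF g that assms(2) D]
      weak_gradient_laplacian[OF g' that assms(2) D] by simp
  obtain C1 where C1: "C1 \<ge> 0" "\<And>x. x \<in> D \<Longrightarrow> norm (\<zeta> x) \<le> C1"
    using continuous_bounded_on[OF smooth_continuous[OF \<zeta>(1)] assms(2)] by metis
  obtain C2 where C2: "C2 \<ge> 0" "\<And>x. x \<in> D \<Longrightarrow> norm (gradient \<zeta> x) \<le> C2"
    using continuous_bounded_on[OF smooth_gradient_continuous[OF \<zeta>(1)] assms(2)] by metis
  obtain C3 where C3: "C3 \<ge> 0" "\<And>x. x \<in> D \<Longrightarrow> norm (laplacian \<zeta> x) \<le> C3"
    using continuous_bounded_on[OF smooth_laplacian_continuous[OF \<zeta>(1)] assms(2)] by metis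
  define C where "C = C1 + C2 + C3"
  define K where "K = C * (4 + 3 * \<bar>lam\<bar>)"
  define err where "err m = (\<integral>x. (u x - \<psi> m x)\<^sup>2 + (norm (g x - gradient (\<psi> m) x))\<^sup>2 \<partial>lebesgue_on D)" for m
  let ?J = "\<integral>x. \<bar>u x\<bar> * (laplacian \<zeta> x + lam * \<zeta> x) \<partial>lebesgue_on D"
  interpret finite_measure "lebesgue_on D"
    by (rule finite_measure_lebesgue_on) (rule bounded_set_imp_lmeasurable[OF assms(2) D])
  have J_int: "integrable (lebesgue_on D) (\<lambda>x. \<bar>u x\<bar> * (laplacian \<zeta> x + lam * \<zeta> x))"
  proof (rule L2_mult_integrable)
    have "(\<lambda>x. \<bar>u x\<bar>) \<in> borel_measurable (lebesgue_on D)"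
      using borel_measurable_integrable[OF u_int] by (rule borel_measurable_abs)
    then show "(\<lambda>x. \<bar>u x\<bar>) \<in> L2 D"
      using uL2 by (simp add: L2_def)
    show "(\<lambda>x. laplacian \<zeta> x + lam * \<zeta> x) \<in> L2 D"
      by (intro continuous_L2 assms(2) D \<zeta>(1) continuous_on_add[OF smooth_laplacian_continuous
            continuous_on_mult[OF continuous_on_const smooth_continuous]])
  qed
  have step: "?J \<ge> - (K * (e * measure lebesgue D + err m / e))" if e: "e > 0" for e m
  proof -
    note sm = test_function_smooth[OF \<psi>[of m]]
    have pos: "(\<psi> m x)\<^sup>2 + e\<^sup>2 > 0" for x
      using e by (simp add: add_nonneg_pos)
    define S where "S x = sqrt ((\<psi> m x)\<^sup>2 + e\<^sup>2)" for x
    have S0: "S x > 0" for x using pos by (simp add: S_def)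
    have smq: "smooth (\<lambda>x. (\<psi> m x)\<^sup>2 + e\<^sup>2)"
      unfolding power2_eq_square by (intro smooth_intros sm)
    have smS: "smooth S"
      using smooth_intros(7)[OF smq pos, of "1/2"] pos
      unfolding S_def by (simp add: powr_half_sqrt less_imp_le)
    have smS': "smooth (\<lambda>x. 1 / S x)"
      using smooth_intros(7)[OF smS S0, of "-1"] S0
      by (simp add: powr_minus powr_one divide_inverse less_imp_le)
    define \<phi> where "\<phi> x = \<psi> m x * (\<zeta> x / S x)" for x
    define \<eta> where "\<eta> x = S x - e" for x
    have \<phi>: "\<phi> \<in> test_functions D"
    proof -
      have "smooth (\<lambda>x. \<zeta> x * (1 / S x))" by (intro smooth_intros \<zeta> smS')
      from test_function_times_smooth[OF \<psi>[of m] this] show ?thesis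
        by (simp add: \<phi>_def[abs_def])
    qed
    have \<eta>: "\<eta> \<in> test_functions D"
    proof (rule test_functionI[OF _ \<psi>[of m]])
      show "smooth \<eta>"
        using smooth_intros(3)[OF smS smooth_intros(1)[of "- e"]] by (simp add: \<eta>_def[abs_def])
      show "{x. \<eta> x \<noteq> 0} \<subseteq> closure {x. \<psi> m x \<noteq> 0}"
        using e closure_subset[of "{x. \<psi> m x \<noteq> 0}"] by (auto simp: \<eta>_def S_def)
    qed
    have dS: "((\<lambda>s. sqrt (s\<^sup>2 + e\<^sup>2)) has_real_derivative s / sqrt (s\<^sup>2 + e\<^sup>2)) (at s)" for s
    proof -
      have "s\<^sup>2 + e\<^sup>2 > 0" using e by (simp add: add_nonneg_pos)
      then show ?thesis by (auto intro!: derivative_eq_intros simp: field_simps)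
    qed
    have dB: "((\<lambda>s. s / sqrt (s\<^sup>2 + e\<^sup>2)) has_real_derivative e\<^sup>2 / sqrt (s\<^sup>2 + e\<^sup>2) ^ 3) (at s)" for s
    proof -
      have p: "s\<^sup>2 + e\<^sup>2 > 0" using e by (simp add: add_nonneg_pos)
      define w where "w = sqrt (s\<^sup>2 + e\<^sup>2)"
      have w: "w > 0" "w * w = s\<^sup>2 + e\<^sup>2" using p by (auto simp: w_def)
      have "((\<lambda>s. s / sqrt (s\<^sup>2 + e\<^sup>2)) has_real_derivative
          (1 * w - s * (s / w)) / (w * w)) (at s)"
        using DERIV_divide[OF DERIV_ident dS[of s]] w(1) e by (simp add: w_def)
      moreover have "(1 * w - s * (s / w)) / (w * w) = (w * w - s * s) / w ^ 3"
        using w(1) by (simp add: field_simps power3_eq_cube)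
      ultimately show ?thesis
        unfolding w(2) by (simp add: w_def power2_eq_square)
    qed
    have g\<eta>: "gradient \<eta> x = (\<psi> m x / S x) *\<^sub>R gradient (\<psi> m) x" for x
    proof (rule gradient_eqI)
      fix b :: 'a assume b: "b \<in> Basis"
      have "((\<lambda>s. sqrt (s\<^sup>2 + e\<^sup>2) - e) has_real_derivative s / sqrt (s\<^sup>2 + e\<^sup>2)) (at s)" for s
        using DERIV_diff[OF dS DERIV_const[of e]] by simp
      from partial_deriv_compose[OF sm this, where b=b and x=x]
      show "partial_deriv b \<eta> x = (\<psi> m x / S x) *\<^sub>R gradient (\<psi> m) x \<bullet> b"
        using b by (simp add: \<eta>_def[abs_def] S_def gradient_inner)
    qed
    have sm\<beta>: "smooth (\<lambda>x. \<psi> m x / S x)"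
      using smooth_intros(4)[OF sm smS'] by simp
    have g\<phi>: "gradient \<phi> x = (\<psi> m x / S x) *\<^sub>R gradient \<zeta> x
        + (\<zeta> x * (e\<^sup>2 / S x ^ 3)) *\<^sub>R gradient (\<psi> m) x" for x
    proof (rule gradient_eqI)
      fix b :: 'a assume b: "b \<in> Basis"
      have "\<phi> = (\<lambda>x. \<zeta> x * (\<psi> m x / S x))" by (simp add: \<phi>_def fun_eq_iff)
      then show "partial_deriv b \<phi> x = ((\<psi> m x / S x) *\<^sub>R gradient \<zeta> x
          + (\<zeta> x * (e\<^sup>2 / S x ^ 3)) *\<^sub>R gradient (\<psi> m) x) \<bullet> b"
        using b partial_deriv_mult[OF \<zeta>(1) sm\<beta>, where b=b and x=x] partial_deriv_compose[OF sm dB, where b=b and x=x]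
        by (simp add: S_def gradient_inner inner_add_left mult.assoc mult.commute mult.left_commute)
    qed
    have L2s: "gradient \<phi> \<in> L2 D" "gradient (\<psi> m) \<in> L2 D" "\<phi> \<in> L2 D" "\<psi> m \<in> L2 D"
      using \<phi> \<psi> assms(2) D
      by (auto intro!: continuous_L2 smooth_gradient_continuous smooth_continuous test_function_smooth)
    have int1: "integrable (lebesgue_on D) (\<lambda>x. g x \<bullet> gradient \<phi> x)"
      "integrable (lebesgue_on D) (\<lambda>x. u x * \<phi> x)"
      by (intro L2_inner_integrable L2_mult_integrable gL2 uL2 L2s)+
    have int2: "integrable (lebesgue_on D) (\<lambda>x. gradient \<eta> x \<bullet> gradient \<zeta> x + \<eta> x * laplacian \<zeta> x)"
      by (intro continuous_integrable_lebesgue_on assms(2) D \<zeta>(1) test_function_smooth[OF \<eta>]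
          continuous_on_add[OF continuous_on_inner[OF smooth_gradient_continuous
            smooth_gradient_continuous] continuous_on_mult[OF smooth_continuous
            smooth_laplacian_continuous]])
    have int3: "integrable (lebesgue_on D) (\<lambda>x. (u x - \<psi> m x)\<^sup>2 + (norm (g x - gradient (\<psi> m) x))\<^sup>2)"
      using L2_diff_integrable[OF uL2 L2s(4)] L2_diff_integrable[OF gL2 L2s(2)] by auto
    let ?lhs = "\<lambda>x. (g x \<bullet> gradient \<phi> x - lam * (u x * \<phi> x))
        - (gradient \<eta> x \<bullet> gradient \<zeta> x + \<eta> x * laplacian \<zeta> x)"
    let ?rhs = "\<lambda>x. - (\<bar>u x\<bar> * (laplacian \<zeta> x + lam * \<zeta> x))
        - K * (e + ((u x - \<psi> m x)\<^sup>2 + (norm (g x - gradient (\<psi> m) x))\<^sup>2) / e)"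
    have "(\<integral>x. ?rhs x \<partial>lebesgue_on D) \<le> (\<integral>x. ?lhs x \<partial>lebesgue_on D)"
    proof (rule integral_mono)
      fix x assume "x \<in> space (lebesgue_on D)"
      then have "x \<in> D" by simp
      then have "\<zeta> x \<le> C" "norm (gradient \<zeta> x) \<le> C" "\<bar>laplacian \<zeta> x\<bar> \<le> C"
        using C1 C2 C3 by (fastforce simp: C_def)+
      from kato_pointwise[OF e \<zeta>(2) this,
          where G="g x" and s="\<psi> m x" and \<Psi>="gradient (\<psi> m) x" and lam=lam and u="u x"]
      show "?rhs x \<le> ?lhs x"
        unfolding g\<phi> g\<eta> \<phi>_def \<eta>_def K_def S_def by simp
    qed (use J_int int1 int2 int3 in auto)
    moreover have "(\<integral>x. ?lhs x \<partial>lebesgue_on D) = 0"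
      using int1 int2 weak[OF \<phi>] green_test_function[OF \<eta> \<zeta>(1) assms(2) D] by simp
    moreover have "(\<integral>x. ?rhs x \<partial>lebesgue_on D) = - ?J - K * (e * measure lebesgue D + err m / e)"
      using J_int int3 D unfolding err_def
      by (simp add: measure_restrict_space mult.commute)
    ultimately show ?thesis by linarith
  qed
  have "?J \<ge> - (K * (e * measure lebesgue D))" if e: "e > 0" for e
  proof (rule LIMSEQ_le_const2)
    have "(\<lambda>m. - (K * (e * measure lebesgue D + err m / e)))
        \<longlonglongrightarrow> - (K * (e * measure lebesgue D + 0 / e))"
      using lim unfolding err_def[symmetric] by (intro tendsto_intros) (use e in auto)
    then show "(\<lambda>m. - (K * (e * measure lebesgue D + err m / e))) \<longlonglongrightarrow> - (K * (e * measure lebesgue D))"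
      by simp
  qed (use step[OF e] in auto)
  note * = this
  show ?thesis
  proof (rule tendsto_upperbound)
    show "((\<lambda>e. - (K * (e * measure lebesgue D))) \<longlongrightarrow> 0) (at_right 0)"
      by (auto intro!: tendsto_eq_intros)
    show "\<forall>\<^sub>F e in at_right 0. - (K * (e * measure lebesgue D)) \<le> ?J"
      using * by (simp add: eventually_at_filter)
  qed simp
qed

text \<open>On a bounded domain the square integrable error controls the integrable one through
  \<open>\<bar>r\<bar> \<le> e + r\<^sup>2 / e\<close>.\<close>

lemma H10_L1_approx:
  fixes D :: "'a::euclidean_space set"
  assumes "u \<in> H10 D" and "open D" and "bounded D" and "\<epsilon> > 0"
  obtains \<psi> where "\<psi> \<in> test_functions D" and "(\<integral>x. \<bar>u x - \<psi> x\<bar> \<partial>lebesgue_on D) < \<epsilon>"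
proof -
  have D: "D \<in> sets lebesgue" using assms(2) by auto
  obtain g \<psi> where g: "weak_gradient D u g" and \<psi>: "\<And>m::nat. \<psi> m \<in> test_functions D"
    and lim: "(\<lambda>m. \<integral>x. (u x - \<psi> m x)\<^sup>2 + (norm (g x - gradient (\<psi> m) x))\<^sup>2 \<partial>lebesgue_on D) \<longlonglongrightarrow> 0"
    using assms(1) unfolding H10_def by blast
  have uL2: "u \<in> L2 D" and gL2: "g \<in> L2 D"
    using g by (auto simp: weak_gradient_def)
  interpret finite_measure "lebesgue_on D"
    by (rule finite_measure_lebesgue_on) (rule bounded_set_imp_lmeasurable[OF assms(3) D])
  \<comment> \<open>The added one covers a domain of measure zero.\<close>
  define e where "e = \<epsilon> / (2 * (measure lebesgue D + 1))"
  have mpos: "measure lebesgue D + 1 > 0" by (simp add: add_nonneg_pos)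
  have e: "e > 0" using assms(4) mpos by (simp add: e_def)
  have "\<epsilon> / 2 * e > 0" using e assms(4) by simp
  from order_tendstoD(2)[OF lim this]
  obtain m where m: "(\<integral>x. (u x - \<psi> m x)\<^sup>2 + (norm (g x - gradient (\<psi> m) x))\<^sup>2 \<partial>lebesgue_on D) < \<epsilon> / 2 * e"
    by (auto simp: eventually_sequentially)
  have L2s: "gradient (\<psi> m) \<in> L2 D" "\<psi> m \<in> L2 D"
    by (intro continuous_L2 smooth_gradient_continuous smooth_continuous test_function_smooth[OF \<psi>] assms(3) D)+
  have int3: "integrable (lebesgue_on D) (\<lambda>x. (u x - \<psi> m x)\<^sup>2 + (norm (g x - gradient (\<psi> m) x))\<^sup>2)"
    using L2_diff_integrable[OF uL2 L2s(2)] L2_diff_integrable[OF gL2 L2s(1)] by auto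
  have int4: "integrable (lebesgue_on D) (\<lambda>x. u x - \<psi> m x)"
    using L2_integrable[OF uL2 assms(3) D] L2_integrable[OF L2s(2) assms(3) D] by auto
  have "(\<integral>x. \<bar>u x - \<psi> m x\<bar> \<partial>lebesgue_on D)
      \<le> (\<integral>x. e + ((u x - \<psi> m x)\<^sup>2 + (norm (g x - gradient (\<psi> m) x))\<^sup>2) / e \<partial>lebesgue_on D)"
  proof (rule integral_mono)
    fix x
    have "2 * (\<bar>u x - \<psi> m x\<bar> * e) \<le> e\<^sup>2 + (u x - \<psi> m x)\<^sup>2"
      using sum_squares_bound[of e "\<bar>u x - \<psi> m x\<bar>"] by (simp add: algebra_simps)
    moreover have "0 \<le> \<bar>u x - \<psi> m x\<bar> * e" "0 \<le> (norm (g x - gradient (\<psi> m) x))\<^sup>2" using e by simp_all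
    ultimately have "\<bar>u x - \<psi> m x\<bar> * e \<le> e * e + ((u x - \<psi> m x)\<^sup>2 + (norm (g x - gradient (\<psi> m) x))\<^sup>2)"
      unfolding power2_eq_square[of e] by linarith
    then have "\<bar>u x - \<psi> m x\<bar> \<le> (e * e + ((u x - \<psi> m x)\<^sup>2 + (norm (g x - gradient (\<psi> m) x))\<^sup>2)) / e"
      using e by (simp add: pos_le_divide_eq)
    then show "\<bar>u x - \<psi> m x\<bar> \<le> e + ((u x - \<psi> m x)\<^sup>2 + (norm (g x - gradient (\<psi> m) x))\<^sup>2) / e"
      using e by (simp add: add_divide_distrib)
  qed (use int3 int4 in auto)
  also have "\<dots> = e * measure lebesgue D
      + (\<integral>x. (u x - \<psi> m x)\<^sup>2 + (norm (g x - gradient (\<psi> m) x))\<^sup>2 \<partial>lebesgue_on D) / e"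
    using int3 D by (simp add: measure_restrict_space mult.commute)
  also have "\<dots> < \<epsilon> / 2 + \<epsilon> / 2"
  proof (rule add_le_less_mono)
    have "e * measure lebesgue D \<le> e * (measure lebesgue D + 1)"
      using e by simp
    also have "\<dots> = \<epsilon> / 2"
      using mpos by (simp add: e_def field_simps)
    finally show "e * measure lebesgue D \<le> \<epsilon> / 2" .
  qed (use m e in \<open>simp add: pos_divide_less_eq\<close>)
  finally show ?thesis
    using that[OF \<psi>[of m]] by simp
qed

section \<open>Averages against the heat kernel\<close>

definition heat_kernel :: "real \<Rightarrow> 'a::euclidean_space \<Rightarrow> real"
  where "heat_kernel t z = (4 * pi * t) powr (- (real DIM('a) / 2)) * exp (- ((norm z)\<^sup>2 / (4 * t)))"

lemma heat_kernel_pos: "t > 0 \<Longrightarrow> heat_kernel t z > 0"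
  by (simp add: heat_kernel_def)

lemma heat_kernel_le:
  "heat_kernel t (z :: 'a::euclidean_space) \<le> (4 * pi * t) powr (- (real DIM('a) / 2))" if "t > 0"
  using that by (simp add: heat_kernel_def mult_left_le)

lemma continuous_heat_kernel: "continuous_on UNIV (heat_kernel t)"
  unfolding heat_kernel_def by (cases "t = 0") (auto intro!: continuous_intros)

lemma heat_kernel_measurable [measurable]: "heat_kernel t \<in> borel_measurable borel"
  by (rule borel_measurable_continuous_onI[OF continuous_heat_kernel])

lemma has_derivative_heat_kernel:
  fixes x :: "'a::euclidean_space"
  assumes "t > 0"
  shows "((\<lambda>y. heat_kernel t (x - y)) has_derivative
    (\<lambda>h. (x - y) \<bullet> h / (2 * t) * heat_kernel t (x - y))) (at y)"
proof -
  have "((\<lambda>y. - ((norm (x - y))\<^sup>2 / (4 * t))) has_derivative (\<lambda>h. (x - y) \<bullet> h / (2 * t))) (at y)"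
    unfolding power2_norm_eq_inner
    using assms by (auto intro!: derivative_eq_intros simp: inner_commute field_simps)
  from has_derivative_exp[OF this]
  have "((\<lambda>y. (4 * pi * t) powr (- (real DIM('a) / 2)) * exp (- ((norm (x - y))\<^sup>2 / (4 * t))))
      has_derivative (\<lambda>h. (4 * pi * t) powr (- (real DIM('a) / 2))
        * ((x - y) \<bullet> h / (2 * t) * exp (- ((norm (x - y))\<^sup>2 / (4 * t)))))) (at y)"
    by (rule has_derivative_mult_right)
  then show ?thesis
    unfolding heat_kernel_def by (simp add: mult_ac)
qed

lemma smooth_heat_kernel:
  fixes x :: "'a::euclidean_space"
  shows "smooth (\<lambda>y. heat_kernel t (x - y))"
proof -
  have "heat_kernel t (x - y) = (4 * pi * t) powr (- (real DIM('a) / 2))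
      * exp ((\<Sum>b\<in>Basis. (y \<bullet> b + - (x \<bullet> b)) * (y \<bullet> b + - (x \<bullet> b))) * (- (1 / (4 * t))))" for y
    unfolding heat_kernel_def norm_minus_commute[of x y] power2_norm_eq_inner
    by (subst euclidean_inner) (simp add: inner_diff_left)
  then show ?thesis
    by (simp only:) (intro smooth_intros)
qed

text \<open>Together with \<open>heat_kernel_has_time_derivative\<close> below this is the heat equation; both formulas
  carry the same bracket.\<close>

lemma laplacian_heat_kernel:
  fixes x :: "'a::euclidean_space"
  assumes "t > 0"
  shows "laplacian (\<lambda>y. heat_kernel t (x - y)) y
    = ((norm (x - y))\<^sup>2 / (4 * t\<^sup>2) - real DIM('a) / (2 * t)) * heat_kernel t (x - y)"
proof -
  let ?H = "\<lambda>y. heat_kernel t (x - y)"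
  have 1: "partial_deriv b ?H = (\<lambda>y. (x - y) \<bullet> b / (2 * t) * ?H y)" for b
    by (rule partial_deriv_eqI[OF has_derivative_heat_kernel[OF assms]])
  have "((\<lambda>y. (x - y) \<bullet> b / (2 * t)) has_derivative (\<lambda>h. - (h \<bullet> b) / (2 * t))) (at y)" for b y
    using assms by (auto intro!: derivative_eq_intros)
  from has_derivative_mult[OF this has_derivative_heat_kernel[OF assms]]
  have 2: "partial_deriv b (\<lambda>y. (x - y) \<bullet> b / (2 * t) * ?H y)
     = (\<lambda>y. (x - y) \<bullet> b / (2 * t) * ((x - y) \<bullet> b / (2 * t) * ?H y) + - (b \<bullet> b) / (2 * t) * ?H y)" for b
    by (rule partial_deriv_eqI)
  have *: "c / (2 * t) * (c / (2 * t) * h) + - 1 / (2 * t) * h = (c\<^sup>2 / (4 * t\<^sup>2) - 1 / (2 * t)) * h"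
    for c h :: real
    by (simp add: power2_eq_square algebra_simps)
  have "laplacian ?H y = (\<Sum>b\<in>Basis. (((x - y) \<bullet> b)\<^sup>2 / (4 * t\<^sup>2) - 1 / (2 * t)) * ?H y)"
    unfolding laplacian_def 1 fun_cong[OF 2]
    by (intro sum.cong refl) (simp only: inner_Basis refl simp_thms if_True *)
  also have "\<dots> = ((\<Sum>b\<in>Basis. ((x - y) \<bullet> b)\<^sup>2) / (4 * t\<^sup>2) - real DIM('a) / (2 * t)) * ?H y"
    by (simp add: sum_distrib_right[symmetric] sum_subtractf sum_divide_distrib[symmetric])
  also have "(\<Sum>b\<in>Basis. ((x - y) \<bullet> b)\<^sup>2) = (norm (x - y))\<^sup>2"
    unfolding power2_norm_eq_inner by (subst euclidean_inner) (simp add: power2_eq_square)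
  finally show ?thesis .
qed

lemma heat_kernel_has_time_derivative:
  fixes z :: "'a::euclidean_space"
  assumes "t > 0"
  shows "((\<lambda>t. exp (lam * t) * heat_kernel t z) has_real_derivative
    ((norm z)\<^sup>2 / (4 * t\<^sup>2) - real DIM('a) / (2 * t) + lam) * (exp (lam * t) * heat_kernel t z)) (at t)"
proof -
  have "(4 * pi * t) powr (- (real DIM('a) / 2) - 1)
      = (4 * pi * t) powr (- (real DIM('a) / 2)) / (4 * pi * t)"
    using assms by (simp add: powr_diff)
  then show ?thesis
    unfolding heat_kernel_def using assms
    by (auto intro!: derivative_eq_intros simp: field_simps power2_eq_square)
qed

text \<open>The kernel is a product of one-dimensional normal densities of variance \<open>2 * t\<close>.\<close>

lemma nn_integral_heat_kernel:
  fixes x :: "'a::euclidean_space"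
  assumes t: "t > 0"
  shows "(\<integral>\<^sup>+y. ennreal (heat_kernel t (x - y)) \<partial>lborel) = 1"
proof -
  have "heat_kernel t (x - y) = (\<Prod>b\<in>Basis. normal_density (x \<bullet> b) (sqrt (2 * t)) (y \<bullet> b))" for y
  proof -
    have s: "sqrt (4 * pi * t) = (4 * pi * t) powr (1 / 2)"
      using t by (simp add: powr_half_sqrt)
    have "(\<Prod>b\<in>(Basis::'a set). normal_density (x \<bullet> b) (sqrt (2 * t)) (y \<bullet> b))
      = (1 / sqrt (4 * pi * t)) ^ DIM('a) * exp (\<Sum>b\<in>Basis. - ((y \<bullet> b - x \<bullet> b)\<^sup>2 / (4 * t)))"
      using t by (simp add: normal_density_def prod.distrib exp_sum prod_dividef power_divide mult_ac)
    also have "(1 / sqrt (4 * pi * t)) ^ DIM('a) = (4 * pi * t) powr (- (real DIM('a) / 2))"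
      unfolding s using t
      by (simp add: power_one_over powr_power powr_minus_divide)
    also have "(\<Sum>b\<in>(Basis::'a set). - ((y \<bullet> b - x \<bullet> b)\<^sup>2 / (4 * t))) = - ((norm (x - y))\<^sup>2 / (4 * t))"
      unfolding norm_minus_commute[of x y] power2_norm_eq_inner
      by (subst euclidean_inner)
         (simp add: inner_diff_left sum_negf sum_divide_distrib power2_eq_square)
    finally show ?thesis by (simp add: heat_kernel_def)
  qed
  then have "(\<integral>\<^sup>+y. ennreal (heat_kernel t (x - y)) \<partial>lborel)
      = (\<integral>\<^sup>+y. (\<Prod>b\<in>Basis. ennreal (normal_density (x \<bullet> b) (sqrt (2 * t)) (y \<bullet> b))) \<partial>lborel)"
    by (simp add: prod_ennreal)
  also have "\<dots> = (\<Prod>b\<in>(Basis::'a set). \<integral>\<^sup>+y. ennreal (normal_density (x \<bullet> b) (sqrt (2 * t)) y) \<partial>lborel)"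
    by (rule nn_integral_lborel_prod) auto
  also have "\<dots> = 1"
    using t by (intro prod.neutral ballI) (simp add: nn_integral_eq_integral)
  finally show ?thesis .
qed

lemma integrable_heat_kernel: "t > 0 \<Longrightarrow> integrable lborel (\<lambda>y. heat_kernel t (x - y))"
  by (rule integrableI_nonneg) (auto simp: nn_integral_heat_kernel heat_kernel_pos less_imp_le)

lemma integral_heat_kernel: "t > 0 \<Longrightarrow> (\<integral>y. heat_kernel t (x - y) \<partial>lborel) = 1"
  by (rule integral_eq_nn_integral[THEN trans])
     (auto simp: nn_integral_heat_kernel heat_kernel_pos less_imp_le)

text \<open>Differentiation under the integral sign, by dominated convergence of the difference quotients.
  A constant bound on \<open>k'\<close> near \<open>t\<close> suffices since the weight is integrable.\<close>

lemma has_real_derivative_weighted_integral: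
  fixes k k' :: "real \<Rightarrow> 'a \<Rightarrow> real"
  assumes t: "a < t" "t < b" and w: "integrable M w"
    and k: "\<And>s. k s \<in> borel_measurable M" "\<And>s. integrable M (\<lambda>y. w y * k s y)"
    and k': "k' t \<in> borel_measurable M"
    and deriv: "\<And>s y. y \<in> space M \<Longrightarrow> a < s \<Longrightarrow> s < b \<Longrightarrow>
      ((\<lambda>s. k s y) has_real_derivative k' s y) (at s)"
    and bound: "\<And>s y. y \<in> space M \<Longrightarrow> a < s \<Longrightarrow> s < b \<Longrightarrow> \<bar>k' s y\<bar> \<le> C"
  shows "((\<lambda>s. \<integral>y. w y * k s y \<partial>M) has_real_derivative (\<integral>y. w y * k' t y \<partial>M)) (at t)"
proof -
  have [measurable]: "w \<in> borel_measurable M" using w by auto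
  note [measurable] = k(1) k'
  define q where "q h y = w y * ((k (t + h) y - k t y) / h)" for h y
  \<comment> \<open>Increments that keep the time inside the interval on which the bound holds.\<close>
  define S where "S = {a - t<..<b - t}"
  have S: "open S" "0 \<in> S" using t by (auto simp: S_def)
  have quot: "\<bar>(k (t + h) y - k t y) / h\<bar> \<le> C" if y: "y \<in> space M" and h: "h \<in> S" "h \<noteq> 0" for h y
  proof -
    have "norm (k (t + h) y - k t y) \<le> C * norm (t + h - t)"
    proof (rule field_differentiable_bound[of "{a<..<b}"])
      show "((\<lambda>s. k s y) has_field_derivative k' s y) (at s within {a<..<b})" if "s \<in> {a<..<b}" for s
        using deriv[OF y] that by (auto intro: has_field_derivative_at_within)
    qed (use bound[OF y] t h in \<open>auto simp: S_def\<close>)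
    then show ?thesis using h(2) by (simp add: pos_divide_le_eq)
  qed
  have "((\<lambda>h. \<integral>y. q h y \<partial>M) \<longlongrightarrow> (\<integral>y. w y * k' t y \<partial>M)) (at 0 within S)"
    unfolding tendsto_at_iff_sequentially
  proof (intro allI impI)
    fix X :: "nat \<Rightarrow> real" assume X: "\<forall>i. X i \<in> S - {0}" "X \<longlonglongrightarrow> 0"
    have "(\<lambda>i. \<integral>y. q (X i) y \<partial>M) \<longlonglongrightarrow> (\<integral>y. w y * k' t y \<partial>M)"
    proof (rule integral_dominated_convergence)
      show "integrable M (\<lambda>y. \<bar>w y\<bar> * C)" using w by auto
      show "AE y in M. norm (q (X i) y) \<le> \<bar>w y\<bar> * C" for i
      proof (rule AE_I2)
        fix y assume "y \<in> space M"
        then have "\<bar>(k (t + X i) y - k t y) / X i\<bar> \<le> C"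
          using quot X(1) by auto
        then show "norm (q (X i) y) \<le> \<bar>w y\<bar> * C"
          unfolding q_def real_norm_def abs_mult by (intro mult_left_mono) auto
      qed
      show "AE y in M. (\<lambda>i. q (X i) y) \<longlonglongrightarrow> w y * k' t y"
      proof (rule AE_I2)
        fix y assume y: "y \<in> space M"
        have "((\<lambda>h. (k (t + h) y - k t y) / h) \<longlongrightarrow> k' t y) (at 0)"
          using deriv[OF y t] by (simp add: DERIV_def)
        moreover have "filterlim X (at 0) sequentially"
          using X by (simp add: filterlim_at)
        ultimately have "(\<lambda>i. (k (t + X i) y - k t y) / X i) \<longlonglongrightarrow> k' t y"
          by (rule filterlim_compose)
        then show "(\<lambda>i. q (X i) y) \<longlonglongrightarrow> w y * k' t y"
          unfolding q_def by (rule tendsto_mult_left)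
      qed
    qed (unfold q_def, measurable)
    then show "((\<lambda>h. \<integral>y. q h y \<partial>M) \<circ> X) \<longlonglongrightarrow> (\<integral>y. w y * k' t y \<partial>M)"
      by (simp add: o_def)
  qed
  then have "((\<lambda>h. \<integral>y. q h y \<partial>M) \<longlongrightarrow> (\<integral>y. w y * k' t y \<partial>M)) (at 0)"
    by (simp only: at_within_open[OF S(2,1)])
  moreover have "(\<integral>y. q h y \<partial>M) = ((\<integral>y. w y * k (t + h) y \<partial>M) - (\<integral>y. w y * k t y \<partial>M)) / h" for h
  proof -
    have "(\<integral>y. q h y \<partial>M) = (\<integral>y. (w y * k (t + h) y - w y * k t y) / h \<partial>M)"
      by (simp add: q_def right_diff_distrib)
    then show ?thesis using k(2) by simp
  qed
  ultimately show ?thesis by (simp add: DERIV_def)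
qed

text \<open>By the heat equation the time derivative of the left-hand side is
  \<open>exp (lam * t)\<close> times the integral of \<open>\<bar>u\<bar> \<cdot> (laplacian \<zeta> + lam * \<zeta>)\<close> for the Gaussian \<open>\<zeta>\<close> centred
  at \<open>x\<close>, and this is nonnegative by Kato's inequality.\<close>

lemma heat_average_mono:
  fixes D :: "'a::euclidean_space set"
  assumes "open D" and "bounded D" and "dirichlet_eigenpair D lam u" and "0 < s" and "s \<le> t"
  shows "exp (lam * s) * (\<integral>y. \<bar>u y\<bar> * heat_kernel s (x - y) \<partial>lebesgue_on D)
    \<le> exp (lam * t) * (\<integral>y. \<bar>u y\<bar> * heat_kernel t (x - y) \<partial>lebesgue_on D)"
proof -
  have D: "D \<in> sets lebesgue" using assms(1) by auto
  have uL2: "u \<in> L2 D"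
    using assms(3) by (auto simp: dirichlet_eigenpair_def weak_gradient_def)
  then have u_abs: "(\<lambda>y. \<bar>u y\<bar>) \<in> L2 D"
    by (auto simp: L2_def)
  have u_int: "integrable (lebesgue_on D) (\<lambda>y. \<bar>u y\<bar>)"
    by (rule L2_integrable[OF u_abs assms(2) D])
  define k where "k \<tau> y = exp (lam * \<tau>) * heat_kernel \<tau> (x - y)" for \<tau> y
  define k' where "k' \<tau> y = ((norm (x - y))\<^sup>2 / (4 * \<tau>\<^sup>2) - real DIM('a) / (2 * \<tau>) + lam) * k \<tau> y" for \<tau> y
  have cont_h: "continuous_on UNIV (\<lambda>y. heat_kernel \<tau> (x - y))" for \<tau>
    by (rule smooth_continuous[OF smooth_heat_kernel])
  have cont_k: "continuous_on UNIV (k \<tau>)" for \<tau>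
    unfolding k_def by (intro continuous_intros cont_h)
  have cont_k': "continuous_on UNIV (k' \<tau>)" if "\<tau> > 0" for \<tau>
    unfolding k'_def using that by (intro continuous_intros cont_k) auto
  obtain r where r: "\<And>y. y \<in> D \<Longrightarrow> norm (x - y) \<le> r"
    using assms(2) bounded_any_center[of D x] by (auto simp: dist_norm)
  have deriv: "((\<lambda>\<tau>. \<integral>y. \<bar>u y\<bar> * k \<tau> y \<partial>lebesgue_on D) has_real_derivative
      (\<integral>y. \<bar>u y\<bar> * k' \<tau> y \<partial>lebesgue_on D)) (at \<tau>)" if \<tau>: "s \<le> \<tau>" "\<tau> \<le> t" for \<tau>
  proof (rule has_real_derivative_weighted_integral)
    show "s / 2 < \<tau>" "\<tau> < t + 1" using that assms(4) by auto
    show "integrable (lebesgue_on D) (\<lambda>y. \<bar>u y\<bar> * k \<sigma> y)" for \<sigma>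
      by (intro L2_mult_integrable u_abs continuous_L2 cont_k assms(2) D)
    show "k \<sigma> \<in> borel_measurable (lebesgue_on D)" for \<sigma>
      by (intro continuous_measurable_lebesgue_on cont_k D)
    show "k' \<tau> \<in> borel_measurable (lebesgue_on D)"
      using \<tau> assms(4) by (intro continuous_measurable_lebesgue_on cont_k' D) auto
    fix \<sigma> y assume y: "y \<in> space (lebesgue_on D)" and \<sigma>: "s / 2 < \<sigma>" "\<sigma> < t + 1"
    have \<sigma>0: "\<sigma> > 0" using \<sigma>(1) assms(4) by simp
    show "((\<lambda>s. k s y) has_real_derivative k' \<sigma> y) (at \<sigma>)"
      unfolding k_def k'_def by (rule heat_kernel_has_time_derivative[OF \<sigma>0])
    have "norm (x - y) \<le> r" using r y by simp
    then have "\<bar>(norm (x - y))\<^sup>2 / (4 * \<sigma>\<^sup>2) - real DIM('a) / (2 * \<sigma>) + lam\<bar>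
        \<le> (norm (x - y))\<^sup>2 / (4 * \<sigma>\<^sup>2) + real DIM('a) / (2 * \<sigma>) + \<bar>lam\<bar>"
      using \<sigma>0 by (intro order_trans[OF abs_triangle_ineq] order_trans[OF abs_triangle_ineq4] add_mono) auto
    also have "\<dots> \<le> r\<^sup>2 / (4 * (s / 2)\<^sup>2) + real DIM('a) / (2 * (s / 2)) + \<bar>lam\<bar>"
      using \<sigma> \<sigma>0 assms(4) \<open>norm (x - y) \<le> r\<close>
      by (intro add_mono frac_le mult_left_mono power_mono order_refl) auto
    finally have 1: "\<bar>(norm (x - y))\<^sup>2 / (4 * \<sigma>\<^sup>2) - real DIM('a) / (2 * \<sigma>) + lam\<bar>
        \<le> r\<^sup>2 / (4 * (s / 2)\<^sup>2) + real DIM('a) / (2 * (s / 2)) + \<bar>lam\<bar>" .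
    have "\<bar>k \<sigma> y\<bar> = exp (lam * \<sigma>) * heat_kernel \<sigma> (x - y)"
      using heat_kernel_pos[OF \<sigma>0, of "x - y"] by (simp add: k_def abs_mult)
    also have "\<dots> \<le> exp (\<bar>lam\<bar> * (t + 1)) * (4 * pi * (s / 2)) powr (- (real DIM('a) / 2))"
    proof (intro mult_mono)
      have "lam * \<sigma> \<le> \<bar>lam\<bar> * (t + 1)"
        using \<sigma> \<sigma>0 by (intro mult_mono) auto
      then show "exp (lam * \<sigma>) \<le> exp (\<bar>lam\<bar> * (t + 1))" by simp
      have "heat_kernel \<sigma> (x - y) \<le> (4 * pi * \<sigma>) powr (- (real DIM('a) / 2))"
        by (rule heat_kernel_le[OF \<sigma>0])
      also have "\<dots> \<le> (4 * pi * (s / 2)) powr (- (real DIM('a) / 2))"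
        using \<sigma> assms(4) by (intro powr_mono2') auto
      finally show "heat_kernel \<sigma> (x - y) \<le> (4 * pi * (s / 2)) powr (- (real DIM('a) / 2))" .
    qed (use heat_kernel_pos[OF \<sigma>0, of "x - y"] in auto)
    finally have 2: "\<bar>k \<sigma> y\<bar> \<le> exp (\<bar>lam\<bar> * (t + 1)) * (4 * pi * (s / 2)) powr (- (real DIM('a) / 2))" .
    show "\<bar>k' \<sigma> y\<bar> \<le> (r\<^sup>2 / (4 * (s / 2)\<^sup>2) + real DIM('a) / (2 * (s / 2)) + \<bar>lam\<bar>)
        * (exp (\<bar>lam\<bar> * (t + 1)) * (4 * pi * (s / 2)) powr (- (real DIM('a) / 2)))"
      unfolding k'_def abs_mult using 1 2 by (intro mult_mono) (auto intro: order_trans[OF abs_ge_zero])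
  qed (rule u_int)
  have nonneg: "(\<integral>y. \<bar>u y\<bar> * k' \<tau> y \<partial>lebesgue_on D) \<ge> 0" if "s \<le> \<tau>" for \<tau>
  proof -
    have \<tau>: "\<tau> > 0" using that assms(4) by simp
    have "0 \<le> exp (lam * \<tau>) * (\<integral>y. \<bar>u y\<bar> * (laplacian (\<lambda>y. heat_kernel \<tau> (x - y)) y
        + lam * heat_kernel \<tau> (x - y)) \<partial>lebesgue_on D)"
      by (intro mult_nonneg_nonneg kato[OF assms(1,2,3) smooth_heat_kernel] exp_ge_zero
          heat_kernel_pos[OF \<tau>, THEN less_imp_le])
    also have "\<dots> = (\<integral>y. \<bar>u y\<bar> * k' \<tau> y \<partial>lebesgue_on D)"
      unfolding integral_mult_right_zero[symmetric] laplacian_heat_kernel[OF \<tau>] k'_def k_def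
      by (intro Bochner_Integration.integral_cong refl) (simp add: algebra_simps)
    finally show ?thesis .
  qed
  have "(\<integral>y. \<bar>u y\<bar> * k s y \<partial>lebesgue_on D) \<le> (\<integral>y. \<bar>u y\<bar> * k t y \<partial>lebesgue_on D)"
    by (rule DERIV_nonneg_imp_nondecreasing[OF assms(5)]) (use deriv nonneg in blast)
  moreover have "(\<integral>y. \<bar>u y\<bar> * k \<tau> y \<partial>lebesgue_on D)
      = exp (lam * \<tau>) * (\<integral>y. \<bar>u y\<bar> * heat_kernel \<tau> (x - y) \<partial>lebesgue_on D)" for \<tau>
    unfolding k_def integral_mult_right_zero[symmetric] by (simp add: mult.left_commute)
  ultimately show ?thesis by simp
qed

section \<open>The heat kernel as an approximate identity\<close>

text \<open>Away from the origin half of the Gaussian exponent is given up as an explicit small factor; the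
  other half is, up to normalisation, the kernel of twice the time, whose mass is one. So the mass
  outside a ball tends to zero with the time.\<close>

lemma heat_kernel_tail:
  fixes z :: "'a::euclidean_space"
  assumes "s > 0" and "0 \<le> \<delta>" and "\<delta> \<le> norm z"
  shows "heat_kernel s z
    \<le> 2 powr (real DIM('a) / 2) * exp (- (\<delta>\<^sup>2 / (8 * s))) * heat_kernel (2 * s) z"
proof -
  let ?n = "real DIM('a) / 2"
  have "(4 * pi * (2 * s)) powr (- ?n) = 2 powr (- ?n) * (4 * pi * s) powr (- ?n)"
    using assms(1) by (simp add: mult_ac flip: powr_mult)
  then have 1: "(4 * pi * s) powr (- ?n) = 2 powr ?n * (4 * pi * (2 * s)) powr (- ?n)"
    by (simp add: powr_minus)
  have "\<delta>\<^sup>2 \<le> (norm z)\<^sup>2" using assms by (intro power_mono)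
  then have "- ((norm z)\<^sup>2 / (4 * s)) \<le> - (\<delta>\<^sup>2 / (8 * s)) + - ((norm z)\<^sup>2 / (4 * (2 * s)))"
    using assms(1) by (simp add: field_simps)
  then have 2: "exp (- ((norm z)\<^sup>2 / (4 * s))) \<le> exp (- (\<delta>\<^sup>2 / (8 * s))) * exp (- ((norm z)\<^sup>2 / (4 * (2 * s))))"
    by (simp flip: exp_add)
  have "heat_kernel s z \<le> (4 * pi * s) powr (- ?n)
      * (exp (- (\<delta>\<^sup>2 / (8 * s))) * exp (- ((norm z)\<^sup>2 / (4 * (2 * s)))))"
    unfolding heat_kernel_def using 2 by (rule mult_left_mono) simp
  then show ?thesis
    unfolding 1 heat_kernel_def by (simp add: mult_ac)
qed

lemma heat_kernel_convolution_integrable: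
  fixes f :: "'a::euclidean_space \<Rightarrow> real"
  assumes "integrable lborel f" and "s > 0"
  shows "integrable lborel (\<lambda>y. heat_kernel s (x - y) * f y)"
proof (rule Bochner_Integration.integrable_bound)
  show "integrable lborel (\<lambda>y. (4 * pi * s) powr (- (real DIM('a) / 2)) * f y)"
    using assms(1) by auto
  show "AE y in lborel. norm (heat_kernel s (x - y) * f y)
      \<le> norm ((4 * pi * s) powr (- (real DIM('a) / 2)) * f y)"
  proof (rule AE_I2)
    fix y
    show "norm (heat_kernel s (x - y) * f y) \<le> norm ((4 * pi * s) powr (- (real DIM('a) / 2)) * f y)"
      using heat_kernel_le[OF assms(2), of "x - y"] heat_kernel_pos[OF assms(2), of "x - y"]
      by (simp add: abs_mult mult_right_mono)
  qed
qed (use assms(1) in measurable)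

lemma heat_kernel_convolution_uniform:
  fixes w :: "'a::euclidean_space \<Rightarrow> real"
  assumes cont: "continuous_on UNIV w" and W: "\<And>x. \<bar>w x\<bar> \<le> W" and D: "bounded D" and \<eta>: "\<eta> > 0"
    and int: "integrable lborel w"
  shows "\<forall>\<^sub>F s in at_right 0. \<forall>x\<in>D. \<bar>w x - (\<integral>y. heat_kernel s (x - y) * w y \<partial>lborel)\<bar> \<le> \<eta>"
proof -
  obtain r where r: "\<And>x. x \<in> D \<Longrightarrow> norm x \<le> r"
    using D by (auto simp: bounded_iff)
  have "uniformly_continuous_on (cball 0 (r + 1)) w"
    using cont by (intro compact_uniformly_continuous) (auto intro: continuous_on_subset)
  then obtain \<delta>' where \<delta>': "\<delta>' > 0" "\<And>x y. x \<in> cball 0 (r + 1) \<Longrightarrow> y \<in> cball 0 (r + 1) \<Longrightarrow>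
      dist y x < \<delta>' \<Longrightarrow> dist (w y) (w x) < \<eta> / 2"
    unfolding uniformly_continuous_on_def using \<eta> by (meson half_gt_zero)
  define \<delta> where "\<delta> = min \<delta>' 1"
  have \<delta>: "\<delta> > 0" using \<delta>'(1) by (simp add: \<delta>_def)
  have near: "\<bar>w x - w y\<bar> \<le> \<eta> / 2" if "x \<in> D" "norm (x - y) < \<delta>" for x y
  proof -
    have "norm y \<le> norm x + norm (x - y)"
      using norm_triangle_ineq4[of x "x - y"] by simp
    then have "y \<in> cball 0 (r + 1)" "x \<in> cball 0 (r + 1)"
      using r[OF that(1)] that(2) by (auto simp: \<delta>_def)
    from \<delta>'(2)[OF this] show ?thesis
      using that(2) by (simp add: dist_norm \<delta>_def)
  qed
  have W0: "W \<ge> 0" using W[of 0] by linarith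
  define c where "c = 2 powr (real DIM('a) / 2)"
  have c: "c > 0" by (simp add: c_def)
  have key: "\<bar>w x - (\<integral>y. heat_kernel s (x - y) * w y \<partial>lborel)\<bar>
      \<le> \<eta> / 2 + 2 * W * c * (8 * s / \<delta>\<^sup>2)" if s: "s > 0" and x: "x \<in> D" for s x
  proof -
    define E where "E = exp (- (\<delta>\<^sup>2 / (8 * s)))"
    have E: "E \<le> 8 * s / \<delta>\<^sup>2"
    proof -
      have "\<delta>\<^sup>2 / (8 * s) \<le> exp (\<delta>\<^sup>2 / (8 * s))"
        using exp_ge_add_one_self[of "\<delta>\<^sup>2 / (8 * s)"] by linarith
      then have "inverse (exp (\<delta>\<^sup>2 / (8 * s))) \<le> inverse (\<delta>\<^sup>2 / (8 * s))"
        using s \<delta> by (intro le_imp_inverse_le) auto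
      then show ?thesis by (simp add: E_def exp_minus)
    qed
    have i1: "integrable lborel (\<lambda>y. heat_kernel s (x - y) * w x)"
      using integrable_heat_kernel[OF s] by auto
    have i2: "integrable lborel (\<lambda>y. heat_kernel s (x - y) * w y)"
      by (rule heat_kernel_convolution_integrable[OF int s])
    have "w x - (\<integral>y. heat_kernel s (x - y) * w y \<partial>lborel)
        = (\<integral>y. heat_kernel s (x - y) * w x - heat_kernel s (x - y) * w y \<partial>lborel)"
      using i1 i2 s by (simp add: integral_heat_kernel)
    also have "\<bar>\<dots>\<bar> \<le> (\<integral>y. \<bar>heat_kernel s (x - y) * w x - heat_kernel s (x - y) * w y\<bar> \<partial>lborel)"
      by (rule integral_abs_bound)
    also have "\<dots> \<le> (\<integral>y. \<eta> / 2 * heat_kernel s (x - y)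
        + 2 * W * (c * E) * heat_kernel (2 * s) (x - y) \<partial>lborel)"
    proof (rule integral_mono)
      show "integrable lborel (\<lambda>y. \<bar>heat_kernel s (x - y) * w x - heat_kernel s (x - y) * w y\<bar>)"
        using i1 i2 by auto
      show "integrable lborel (\<lambda>y. \<eta> / 2 * heat_kernel s (x - y)
        + 2 * W * (c * E) * heat_kernel (2 * s) (x - y))"
        using integrable_heat_kernel[of s x] integrable_heat_kernel[of "2 * s" x] s by auto
      fix y
      have p: "heat_kernel s (x - y) > 0" "heat_kernel (2 * s) (x - y) > 0"
        using s by (auto intro: heat_kernel_pos)
      have "\<bar>heat_kernel s (x - y) * w x - heat_kernel s (x - y) * w y\<bar>
          = heat_kernel s (x - y) * \<bar>w x - w y\<bar>"
        using p by (simp add: abs_mult flip: right_diff_distrib)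
      also have "\<dots> \<le> \<eta> / 2 * heat_kernel s (x - y) + 2 * W * (c * E) * heat_kernel (2 * s) (x - y)"
      proof (cases "norm (x - y) < \<delta>")
        case True
        have "heat_kernel s (x - y) * \<bar>w x - w y\<bar> \<le> heat_kernel s (x - y) * (\<eta> / 2)"
          using near[OF x True] p by (intro mult_left_mono) auto
        moreover have "0 \<le> 2 * W * (c * E) * heat_kernel (2 * s) (x - y)"
          using W0 c p by (simp add: E_def)
        moreover have "heat_kernel s (x - y) * (\<eta> / 2) = \<eta> / 2 * heat_kernel s (x - y)"
          by simp
        ultimately show ?thesis by linarith
      next
        case False
        have "\<bar>w x - w y\<bar> \<le> 2 * W" using W[of x] W[of y] by linarith
        moreover have "heat_kernel s (x - y) \<le> c * E * heat_kernel (2 * s) (x - y)"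
          unfolding c_def E_def using s \<delta> False by (intro heat_kernel_tail) auto
        ultimately have "heat_kernel s (x - y) * \<bar>w x - w y\<bar> \<le> c * E * heat_kernel (2 * s) (x - y) * (2 * W)"
          using p c by (intro mult_mono) (auto simp: E_def)
        moreover have "0 \<le> \<eta> / 2 * heat_kernel s (x - y)" using p \<eta> by simp
        moreover have "c * E * heat_kernel (2 * s) (x - y) * (2 * W)
            = 2 * W * (c * E) * heat_kernel (2 * s) (x - y)"
          by simp
        ultimately show ?thesis by linarith
      qed
      finally show "\<bar>heat_kernel s (x - y) * w x - heat_kernel s (x - y) * w y\<bar>
          \<le> \<eta> / 2 * heat_kernel s (x - y) + 2 * W * (c * E) * heat_kernel (2 * s) (x - y)" .
    qed
    also have "\<dots> = \<eta> / 2 + 2 * W * (c * E)"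
      using integrable_heat_kernel[of s x] integrable_heat_kernel[of "2 * s" x] s
      by (simp add: integral_heat_kernel)
    also have "\<dots> \<le> \<eta> / 2 + 2 * W * (c * (8 * s / \<delta>\<^sup>2))"
      using W0 c E by (intro add_left_mono mult_left_mono) auto
    finally show ?thesis by (simp add: mult.assoc)
  qed
  have "((\<lambda>s. \<eta> / 2 + 2 * W * c * (8 * s / \<delta>\<^sup>2)) \<longlongrightarrow> \<eta> / 2 + 2 * W * c * (8 * 0 / \<delta>\<^sup>2)) (at_right 0)"
    by (intro tendsto_intros) (use \<delta> in auto)
  then have "\<forall>\<^sub>F s in at_right 0. \<eta> / 2 + 2 * W * c * (8 * s / \<delta>\<^sup>2) < \<eta>"
    by (rule order_tendstoD) (use \<eta> in simp)
  then show ?thesis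
    using eventually_at_right_less[of 0]
    by eventually_elim (use key in force)
qed

text \<open>Convolution with a probability density does not increase the integral of the modulus: Tonelli.\<close>

lemma heat_kernel_convolution_L1:
  fixes f :: "'a::euclidean_space \<Rightarrow> real"
  assumes f: "integrable lborel f" and s: "s > 0"
  shows "(\<integral>\<^sup>+x. ennreal \<bar>\<integral>y. heat_kernel s (x - y) * f y \<partial>lborel\<bar> \<partial>lborel) \<le> ennreal (\<integral>y. \<bar>f y\<bar> \<partial>lborel)"
proof -
  have [measurable]: "f \<in> borel_measurable borel" using f by auto
  have "(\<integral>\<^sup>+x. ennreal \<bar>\<integral>y. heat_kernel s (x - y) * f y \<partial>lborel\<bar> \<partial>lborel)
      \<le> (\<integral>\<^sup>+x. \<integral>\<^sup>+y. ennreal (heat_kernel s (x - y)) * ennreal \<bar>f y\<bar> \<partial>lborel \<partial>lborel)"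
  proof (rule nn_integral_mono)
    fix x
    have "ennreal (norm (\<integral>y. heat_kernel s (x - y) * f y \<partial>lborel))
        \<le> (\<integral>\<^sup>+y. ennreal (norm (heat_kernel s (x - y) * f y)) \<partial>lborel)"
      by (rule integral_norm_bound_ennreal[OF heat_kernel_convolution_integrable[OF f s]])
    then show "ennreal \<bar>\<integral>y. heat_kernel s (x - y) * f y \<partial>lborel\<bar>
        \<le> (\<integral>\<^sup>+y. ennreal (heat_kernel s (x - y)) * ennreal \<bar>f y\<bar> \<partial>lborel)"
      by (simp add: abs_mult ennreal_mult less_imp_le[OF heat_kernel_pos[OF s]])
  qed
  also have "\<dots> = (\<integral>\<^sup>+y. \<integral>\<^sup>+x. ennreal (heat_kernel s (x - y)) * ennreal \<bar>f y\<bar> \<partial>lborel \<partial>lborel)"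
    by (rule lborel_pair.Fubini'[symmetric]) measurable
  also have "\<dots> = (\<integral>\<^sup>+y. ennreal \<bar>f y\<bar> \<partial>lborel)"
  proof (rule nn_integral_cong)
    fix y :: 'a
    have "heat_kernel s (x - y) = heat_kernel s (y - x)" for x
      by (simp add: heat_kernel_def norm_minus_commute)
    then show "(\<integral>\<^sup>+x. ennreal (heat_kernel s (x - y)) * ennreal \<bar>f y\<bar> \<partial>lborel) = ennreal \<bar>f y\<bar>"
      by (simp add: nn_integral_multc nn_integral_heat_kernel[OF s])
  qed
  also have "\<dots> = ennreal (\<integral>y. \<bar>f y\<bar> \<partial>lborel)"
    using f by (intro nn_integral_eq_integral) auto
  finally show ?thesis .
qed

text \<open>For a continuous \<open>w\<close> the averages converge uniformly on \<open>D\<close> as the time tends to zero. Since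
  averaging is a contraction in the mean, the averages of \<open>v\<close> and of a close \<open>w\<close> stay close for all
  times, so the bound on the averages passes to \<open>v\<close>. This avoids a theorem on Lebesgue points: only
  the integral of the positive part of \<open>v - M\<close> is estimated.\<close>

lemma AE_le_of_heat_averages_le:
  fixes v :: "'a::euclidean_space \<Rightarrow> real"
  assumes v: "integrable lborel v" and D: "bounded D" "D \<in> sets borel"
    and v0: "\<And>x. x \<notin> D \<Longrightarrow> v x = 0" and M: "M \<ge> 0" and t: "t > 0"
    and approx: "\<And>\<epsilon>. \<epsilon> > 0 \<Longrightarrow> \<exists>w W. continuous_on UNIV w \<and> (\<forall>x. \<bar>w x\<bar> \<le> W) \<and> integrable lborel w \<and>
      (\<integral>x. \<bar>v x - w x\<bar> \<partial>lborel) < \<epsilon>"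
    and le: "\<And>x s. 0 < s \<Longrightarrow> s \<le> t \<Longrightarrow> exp (lam * s) * (\<integral>y. heat_kernel s (x - y) * v y \<partial>lborel) \<le> M"
  shows "AE x in lborel. v x \<le> M"
proof -
  have [measurable]: "v \<in> borel_measurable borel" using v by auto
  note [measurable] = D(2)
  have Dfin: "emeasure lborel D < \<infinity>"
    by (rule emeasure_bounded_finite[OF D(1)])
  define m where "m = measure lborel D"
  have m: "emeasure lborel D = ennreal m"
    using Dfin by (simp add: m_def emeasure_eq_ennreal_measure)
  have m0: "m \<ge> 0" by (simp add: m_def)
  have small: "(\<integral>\<^sup>+x. ennreal (v x - M) \<partial>lborel) \<le> ennreal (\<epsilon> * (3 + 2 * m))" if \<epsilon>: "\<epsilon> > 0" for \<epsilon>
  proof -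
    obtain w W where w: "continuous_on UNIV w" "\<And>x. \<bar>w x\<bar> \<le> W" "integrable lborel w"
      and vw: "(\<integral>x. \<bar>v x - w x\<bar> \<partial>lborel) < \<epsilon>"
      using approx[OF \<epsilon>] by blast
    have [measurable]: "w \<in> borel_measurable borel" using w(3) by auto
    define P where "P s f x = (\<integral>y. heat_kernel s (x - y) * f y \<partial>lborel)" for s f and x :: 'a
    have ev1: "\<forall>\<^sub>F s in at_right 0. \<forall>x\<in>D. \<bar>w x - P s w x\<bar> \<le> \<epsilon>"
      unfolding P_def by (rule heat_kernel_convolution_uniform[OF w(1,2) D(1) \<epsilon> w(3)])
    have lim: "((\<lambda>s. exp (lam * s)) \<longlongrightarrow> exp (lam * 0)) (at_right 0)"
      by (intro tendsto_intros)
    have ev2: "\<forall>\<^sub>F s in at_right 0. exp (lam * s) < 2"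
      using order_tendstoD(2)[OF lim, of 2] by simp
    have "((\<lambda>s. \<bar>1 - exp (lam * s)\<bar> * W) \<longlongrightarrow> \<bar>1 - exp (lam * 0)\<bar> * W) (at_right 0)"
      by (intro tendsto_intros)
    then have ev3: "\<forall>\<^sub>F s in at_right 0. \<bar>1 - exp (lam * s)\<bar> * W < \<epsilon>"
      by (rule order_tendstoD) (use \<epsilon> in simp)
    have ev4: "\<forall>\<^sub>F s in at_right 0. s < t"
      using order_tendstoD(2)[OF tendsto_ident_at, of 0 t "{0<..}"] t by simp
    have "\<forall>\<^sub>F s in at_right 0. (\<forall>x\<in>D. \<bar>w x - P s w x\<bar> \<le> \<epsilon>) \<and> exp (lam * s) < 2
        \<and> \<bar>1 - exp (lam * s)\<bar> * W < \<epsilon> \<and> s < t \<and> 0 < s"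
      using ev1 ev2 ev3 ev4 eventually_at_right_less[of 0] by eventually_elim auto
    then obtain s where s: "\<And>x. x \<in> D \<Longrightarrow> \<bar>w x - P s w x\<bar> \<le> \<epsilon>" "exp (lam * s) < 2"
      "\<bar>1 - exp (lam * s)\<bar> * W < \<epsilon>" "s < t" "0 < s"
      using eventually_happens'[OF trivial_limit_at_right_real] by blast
    let ?c = "exp (lam * s)"
    have Pw: "\<bar>P s w x\<bar> \<le> W" for x
    proof -
      have "\<bar>P s w x\<bar> \<le> (\<integral>y. \<bar>heat_kernel s (x - y) * w y\<bar> \<partial>lborel)"
        unfolding P_def by (rule integral_abs_bound)
      also have "\<dots> \<le> (\<integral>y. heat_kernel s (x - y) * W \<partial>lborel)"
      proof (rule integral_mono)
        show "integrable lborel (\<lambda>y. \<bar>heat_kernel s (x - y) * w y\<bar>)"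
          by (rule integrable_abs[OF heat_kernel_convolution_integrable[OF w(3) s(5)]])
        show "integrable lborel (\<lambda>y. heat_kernel s (x - y) * W)"
          using integrable_heat_kernel[OF s(5)] by auto
        show "\<bar>heat_kernel s (x - y) * w y\<bar> \<le> heat_kernel s (x - y) * W" for y
          using w(2) by (simp add: abs_mult less_imp_le[OF heat_kernel_pos[OF s(5)]] mult_left_mono)
      qed
      finally show ?thesis using s(5) by (simp add: integral_heat_kernel)
    qed
    have P_diff: "P s (\<lambda>x. v x - w x) x = P s v x - P s w x" for x
      unfolding P_def right_diff_distrib
      using heat_kernel_convolution_integrable[OF v s(5)] heat_kernel_convolution_integrable[OF w(3) s(5)]
      by simp
    have [measurable]: "(\<lambda>x. P s f x) \<in> borel_measurable borel" if [measurable]: "f \<in> borel_measurable borel" for f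
      unfolding P_def by measurable
    have pt: "ennreal (v x - M) \<le> ennreal \<bar>v x - w x\<bar> + ennreal (2 * \<epsilon>) * indicator D x
        + 2 * ennreal \<bar>P s (\<lambda>x. v x - w x) x\<bar>" for x
    proof (cases "x \<in> D")
      case True
      have "v x - M \<le> v x - ?c * P s v x"
        using le[of s x] s(4,5) by (simp add: P_def)
      \<comment> \<open>The four differences are small by the choices of \<open>w\<close> and \<open>s\<close>, the first and the last one only in the mean.\<close>
      also have "\<dots> = (v x - w x) + (w x - P s w x) + (1 - ?c) * P s w x - ?c * (P s v x - P s w x)"
        by (simp add: algebra_simps)
      also have "\<dots> \<le> \<bar>v x - w x\<bar> + \<epsilon> + \<epsilon> + 2 * \<bar>P s v x - P s w x\<bar>"
      proof -
        have "w x - P s w x \<le> \<epsilon>" using s(1)[OF True] by linarith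
        moreover have "(1 - ?c) * P s w x \<le> \<epsilon>"
        proof -
          have "\<bar>(1 - ?c) * P s w x\<bar> \<le> \<bar>1 - ?c\<bar> * W"
            unfolding abs_mult using Pw by (intro mult_left_mono) auto
          then show ?thesis using s(3) by linarith
        qed
        moreover have "- (?c * (P s v x - P s w x)) \<le> 2 * \<bar>P s v x - P s w x\<bar>"
        proof -
          have "\<bar>?c * (P s v x - P s w x)\<bar> \<le> 2 * \<bar>P s v x - P s w x\<bar>"
            unfolding abs_mult using s(2) by (intro mult_right_mono) auto
          then show ?thesis by linarith
        qed
        ultimately show ?thesis by linarith
      qed
      finally have "v x - M \<le> \<bar>v x - w x\<bar> + 2 * \<epsilon> + 2 * \<bar>P s (\<lambda>x. v x - w x) x\<bar>"
        by (simp add: P_diff)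
      then have "ennreal (v x - M) \<le> ennreal (\<bar>v x - w x\<bar> + 2 * \<epsilon> + 2 * \<bar>P s (\<lambda>x. v x - w x) x\<bar>)"
        by (rule ennreal_leI)
      then show ?thesis using True \<epsilon> by (simp add: ennreal_plus ennreal_mult)
    next
      case False
      then show ?thesis using v0[OF False] M by (simp add: ennreal_neg)
    qed
    have "(\<integral>\<^sup>+x. ennreal (v x - M) \<partial>lborel) \<le> (\<integral>\<^sup>+x. ennreal \<bar>v x - w x\<bar>
        + ennreal (2 * \<epsilon>) * indicator D x + 2 * ennreal \<bar>P s (\<lambda>x. v x - w x) x\<bar> \<partial>lborel)"
      by (rule nn_integral_mono) (rule pt)
    also have "\<dots> = (\<integral>\<^sup>+x. ennreal \<bar>v x - w x\<bar> \<partial>lborel) + ennreal (2 * \<epsilon>) * emeasure lborel D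
        + 2 * (\<integral>\<^sup>+x. ennreal \<bar>P s (\<lambda>x. v x - w x) x\<bar> \<partial>lborel)"
      by (simp add: nn_integral_add nn_integral_cmult)
    also have "\<dots> \<le> ennreal \<epsilon> + ennreal (2 * \<epsilon>) * ennreal m + 2 * ennreal \<epsilon>"
    proof (intro add_mono mult_left_mono)
      have i: "integrable lborel (\<lambda>x. v x - w x)" using v w(3) by auto
      have "ennreal (\<integral>x. \<bar>v x - w x\<bar> \<partial>lborel) \<le> ennreal \<epsilon>"
        using vw by (intro ennreal_leI) simp
      moreover have "(\<integral>\<^sup>+x. ennreal \<bar>v x - w x\<bar> \<partial>lborel) = ennreal (\<integral>x. \<bar>v x - w x\<bar> \<partial>lborel)"
        using i by (intro nn_integral_eq_integral) auto
      ultimately show "(\<integral>\<^sup>+x. ennreal \<bar>v x - w x\<bar> \<partial>lborel) \<le> ennreal \<epsilon>" by simp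
      show "(\<integral>\<^sup>+x. ennreal \<bar>P s (\<lambda>x. v x - w x) x\<bar> \<partial>lborel) \<le> ennreal \<epsilon>"
        unfolding P_def
        using heat_kernel_convolution_L1[OF i s(5)] \<open>ennreal (\<integral>x. \<bar>v x - w x\<bar> \<partial>lborel) \<le> ennreal \<epsilon>\<close>
        by (rule order_trans)
    qed (auto simp: m)
    also have "\<dots> = ennreal (\<epsilon> + 2 * \<epsilon> * m + 2 * \<epsilon>)"
    proof -
      have "2 * ennreal \<epsilon> = ennreal (2 * \<epsilon>)" "ennreal (2 * \<epsilon>) * ennreal m = ennreal (2 * \<epsilon> * m)"
        using \<epsilon> m0 by (simp add: ennreal_mult, intro ennreal_mult[symmetric]) auto
      then show ?thesis
        using \<epsilon> m0 by (simp only: ennreal_plus[symmetric] add_nonneg_nonneg mult_nonneg_nonneg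
            less_imp_le zero_le_numeral)
    qed
    also have "\<epsilon> + 2 * \<epsilon> * m + 2 * \<epsilon> = \<epsilon> * (3 + 2 * m)"
      by (simp add: algebra_simps)
    finally show ?thesis .
  qed
  have "(\<integral>\<^sup>+x. ennreal (v x - M) \<partial>lborel) \<le> 0"
  proof (rule ennreal_le_epsilon)
    fix e :: real assume "e > 0"
    then show "(\<integral>\<^sup>+x. ennreal (v x - M) \<partial>lborel) \<le> 0 + ennreal e"
      using small[of "e / (3 + 2 * m)"] m0 by (simp add: add_pos_nonneg)
  qed
  then have "AE x in lborel. ennreal (v x - M) = 0"
    by (subst nn_integral_0_iff_AE[symmetric]) (auto simp: le_zero_eq)
  then show ?thesis
    by eventually_elim (simp add: ennreal_eq_0_iff)
qed

section \<open>The eigenfunction estimate\<close>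

text \<open>The weighted averages of \<open>\<bar>u\<bar>\<close> increase up to time \<open>t\<close>, where the kernel is at most
  \<open>(4 * pi * t) powr (- n / 2)\<close>; as the time tends to zero they recover \<open>\<bar>u\<bar>\<close>. Tonelli's theorem
  is applied to Borel functions, which is why \<open>\<bar>u\<bar>\<close>, extended by zero, is first replaced by a Borel
  representative \<open>v\<close>.\<close>

lemma eigenfunction_AE_heat_bound:
  fixes D :: "'a::euclidean_space set"
  assumes oD: "open D" and bD: "bounded D" and eig: "dirichlet_eigenpair D lam u" and t: "t > 0"
  shows "AE x in lebesgue_on D. \<bar>u x\<bar>
    \<le> exp (lam * t) * (4 * pi * t) powr (- (real DIM('a) / 2)) * L1_norm D u"
proof -
  have D: "D \<in> sets lebesgue" "D \<in> sets borel" using oD by auto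
  have H: "u \<in> H10 D" using eig by (simp add: dirichlet_eigenpair_def)
  have uL2: "u \<in> L2 D"
    using eig by (auto simp: dirichlet_eigenpair_def weak_gradient_def)
  then have um [measurable]: "u \<in> borel_measurable (lebesgue_on D)"
    by (simp add: L2_def)
  have u_int: "integrable (lebesgue_on D) u"
    by (rule L2_integrable[OF uL2 bD D(1)])
  define f where "f x = (if x \<in> D then \<bar>u x\<bar> else 0)" for x
  have f_int: "integrable lebesgue f"
    unfolding f_def Lebesgue_Measure.integrable_restrict_UNIV[OF D(1)] using u_int by auto
  then have f_meas: "f \<in> borel_measurable (completion lborel)" by auto
  obtain v' where v' [measurable]: "v' \<in> borel_measurable borel" and fv': "AE x in lborel. f x = v' x"
    using completion_ex_borel_measurable_real[OF f_meas] by auto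
  define v where "v x = indicator D x * \<bar>v' x\<bar>" for x
  have v_meas [measurable]: "v \<in> borel_measurable borel"
    using D(2) unfolding v_def by measurable
  have fv: "AE x in lborel. f x = v x"
    using fv' by eventually_elim (auto simp: f_def v_def indicator_def split: if_splits)
  then have fv_leb: "AE x in lebesgue. f x = v x"
    by (rule AE_completion)
  have v_leb: "v \<in> borel_measurable lebesgue"
    by (rule measurable_completion) simp
  have v_int: "integrable lborel v"
  proof -
    have "integrable lebesgue v"
      using f_int fv_leb v_leb f_meas by (subst integrable_cong_AE[of _ _ f]) (auto elim: eventually_mono)
    then show ?thesis by (subst (asm) integrable_completion) auto
  qed
  have transfer: "(\<integral>x. F (v x) x \<partial>lborel) = (\<integral>x. F \<bar>u x\<bar> x \<partial>lebesgue_on D)"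
    if F: "(\<lambda>x. F (v x) x) \<in> borel_measurable borel" "(\<lambda>x. F \<bar>u x\<bar> x) \<in> borel_measurable (lebesgue_on D)"
      "\<And>x. x \<notin> D \<Longrightarrow> F 0 x = 0" for F :: "real \<Rightarrow> 'a \<Rightarrow> real"
  proof -
    have "(\<integral>x. F (v x) x \<partial>lborel) = (\<integral>x. F (v x) x \<partial>lebesgue)"
      by (rule integral_completion[symmetric]) (use F(1) in simp)
    also have "\<dots> = (\<integral>x. (if x \<in> D then F \<bar>u x\<bar> x else 0) \<partial>lebesgue)"
    proof (rule integral_cong_AE)
      show "(\<lambda>x. F (v x) x) \<in> borel_measurable lebesgue"
        by (rule measurable_completion) (use F(1) in simp)
      show "(\<lambda>x. if x \<in> D then F \<bar>u x\<bar> x else 0) \<in> borel_measurable lebesgue"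
        by (rule borel_measurable_if_I[OF F(2) D(1)])
      show "AE x in lebesgue. F (v x) x = (if x \<in> D then F \<bar>u x\<bar> x else 0)"
        using fv_leb by eventually_elim (use F(3) in \<open>auto simp: f_def v_def indicator_def\<close>)
    qed
    also have "\<dots> = (\<integral>x. F \<bar>u x\<bar> x \<partial>lebesgue_on D)"
      by (rule Lebesgue_Measure.integral_restrict_UNIV[OF D(1)])
    finally show ?thesis .
  qed
  have cont_h: "continuous_on UNIV (\<lambda>y. heat_kernel s (x - y))" for s and x :: 'a
    by (rule smooth_continuous[OF smooth_heat_kernel])
  let ?M = "exp (lam * t) * (4 * pi * t) powr (- (real DIM('a) / 2)) * L1_norm D u"
  have "AE x in lborel. v x \<le> ?M"
  proof (rule AE_le_of_heat_averages_le[OF v_int bD D(2) _ _ t])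
    show "v x = 0" if "x \<notin> D" for x using that by (simp add: v_def)
    show "?M \<ge> 0" by (simp add: L1_norm_def)
  next
    fix \<epsilon> :: real assume \<epsilon>: "\<epsilon> > 0"
    obtain \<psi> where \<psi>: "\<psi> \<in> test_functions D" "(\<integral>x. \<bar>u x - \<psi> x\<bar> \<partial>lebesgue_on D) < \<epsilon>"
      using H10_L1_approx[OF H oD bD \<epsilon>] by blast
    have cont: "continuous_on UNIV (\<lambda>x. \<bar>\<psi> x\<bar>)"
      by (intro continuous_intros smooth_continuous test_function_smooth[OF \<psi>(1)])
    then have [measurable]: "(\<lambda>x. \<bar>\<psi> x\<bar>) \<in> borel_measurable borel"
      by (rule borel_measurable_continuous_onI)
    obtain W where W: "W \<ge> 0" "\<And>x. x \<in> D \<Longrightarrow> norm \<bar>\<psi> x\<bar> \<le> W"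
      using continuous_bounded_on[OF cont bD] by metis
    have zero: "\<psi> x = 0" if "x \<notin> D" for x
      using test_function_zero_outside[OF \<psi>(1) that] .
    have bounded: "\<bar>\<bar>\<psi> x\<bar>\<bar> \<le> W" for x
      using W zero[of x] by (cases "x \<in> D") auto
    have \<psi>_int: "integrable (lebesgue_on D) (\<lambda>x. \<bar>\<psi> x\<bar>)"
      by (rule continuous_integrable_lebesgue_on[OF cont bD D(1)])
    have "integrable lebesgue (\<lambda>x. if x \<in> D then \<bar>\<psi> x\<bar> else 0)"
      unfolding Lebesgue_Measure.integrable_restrict_UNIV[OF D(1)] by (rule \<psi>_int)
    moreover have "(\<lambda>x. if x \<in> D then \<bar>\<psi> x\<bar> else 0) = (\<lambda>x. \<bar>\<psi> x\<bar>)"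
      using zero by auto
    ultimately have int: "integrable lborel (\<lambda>x. \<bar>\<psi> x\<bar>)"
      by (simp add: integrable_completion)
    have m\<psi> [measurable]: "(\<lambda>x. \<bar>\<psi> x\<bar>) \<in> borel_measurable (lebesgue_on D)"
      using \<psi>_int by auto
    have "(\<integral>x. \<bar>v x - \<bar>\<psi> x\<bar>\<bar> \<partial>lborel) = (\<integral>x. \<bar>\<bar>u x\<bar> - \<bar>\<psi> x\<bar>\<bar> \<partial>lebesgue_on D)"
      by (rule transfer) (use zero in auto)
    also have "\<dots> \<le> (\<integral>x. \<bar>u x - \<psi> x\<bar> \<partial>lebesgue_on D)"
    proof (rule integral_mono)
      show "integrable (lebesgue_on D) (\<lambda>x. \<bar>\<bar>u x\<bar> - \<bar>\<psi> x\<bar>\<bar>)"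
        using u_int \<psi>_int by auto
      have "integrable (lebesgue_on D) \<psi>"
        by (intro continuous_integrable_lebesgue_on smooth_continuous test_function_smooth[OF \<psi>(1)] bD D(1))
      then show "integrable (lebesgue_on D) (\<lambda>x. \<bar>u x - \<psi> x\<bar>)"
        using u_int by auto
    qed (rule abs_triangle_ineq3)
    finally have "(\<integral>x. \<bar>v x - \<bar>\<psi> x\<bar>\<bar> \<partial>lborel) < \<epsilon>"
      using \<psi>(2) by simp
    with cont bounded int
    show "\<exists>w W. continuous_on UNIV w \<and> (\<forall>x. \<bar>w x\<bar> \<le> W) \<and> integrable lborel w \<and>
      (\<integral>x. \<bar>v x - w x\<bar> \<partial>lborel) < \<epsilon>"
      by blast
  next
    fix x s assume s: "0 < s" "s \<le> t"
    have eq: "(\<integral>y. heat_kernel s (x - y) * v y \<partial>lborel) = (\<integral>y. heat_kernel s (x - y) * \<bar>u y\<bar> \<partial>lebesgue_on D)" for s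
    proof (rule transfer)
      have "(\<lambda>y. heat_kernel s (x - y)) \<in> borel_measurable (lebesgue_on D)"
        by (rule continuous_measurable_lebesgue_on[OF cont_h D(1)])
      then show "(\<lambda>y. heat_kernel s (x - y) * \<bar>u y\<bar>) \<in> borel_measurable (lebesgue_on D)"
        using um by measurable
    qed auto
    have "exp (lam * s) * (\<integral>y. heat_kernel s (x - y) * v y \<partial>lborel)
        \<le> exp (lam * t) * (\<integral>y. heat_kernel t (x - y) * \<bar>u y\<bar> \<partial>lebesgue_on D)"
      using heat_average_mono[OF oD bD eig s, of x] unfolding eq by (simp add: mult.commute)
    also have "(\<integral>y. heat_kernel t (x - y) * \<bar>u y\<bar> \<partial>lebesgue_on D)
        \<le> (\<integral>y. (4 * pi * t) powr (- (real DIM('a) / 2)) * \<bar>u y\<bar> \<partial>lebesgue_on D)"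
    proof (rule integral_mono)
      have u_abs: "(\<lambda>y. \<bar>u y\<bar>) \<in> L2 D" using uL2 by (auto simp: L2_def)
      show "integrable (lebesgue_on D) (\<lambda>y. heat_kernel t (x - y) * \<bar>u y\<bar>)"
        by (intro L2_mult_integrable u_abs continuous_L2 cont_h bD D(1))
      show "integrable (lebesgue_on D) (\<lambda>y. (4 * pi * t) powr (- (real DIM('a) / 2)) * \<bar>u y\<bar>)"
        using u_int by auto
      show "heat_kernel t (x - y) * \<bar>u y\<bar> \<le> (4 * pi * t) powr (- (real DIM('a) / 2)) * \<bar>u y\<bar>" for y
        using heat_kernel_le[OF t, of "x - y"] by (intro mult_right_mono) auto
    qed
    also have "\<dots> = (4 * pi * t) powr (- (real DIM('a) / 2)) * L1_norm D u"
      by (simp add: L1_norm_def)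
    finally show "exp (lam * s) * (\<integral>y. heat_kernel s (x - y) * v y \<partial>lborel) \<le> ?M"
      by (simp add: mult.assoc)
  qed
  then have "AE x in lebesgue. v x \<le> ?M"
    by (rule AE_completion)
  with fv_leb have "AE x in lebesgue. x \<in> D \<longrightarrow> \<bar>u x\<bar> \<le> ?M"
    by eventually_elim (auto simp: f_def)
  then show ?thesis
    using D(1) by (simp add: AE_restrict_space_iff)
qed

text \<open>For \<open>lam \<le> 0\<close> the bound of the previous lemma tends to zero as \<open>t\<close> grows.\<close>

lemma eigenvalue_pos:
  fixes D :: "'a::euclidean_space set"
  assumes "open D" and "bounded D" and "dirichlet_eigenpair D lam u"
  shows "lam > 0"
proof (rule ccontr)
  assume "\<not> lam > 0"
  then have lam: "lam \<le> 0" by simp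
  have all: "AE x in lebesgue_on D. \<forall>k. \<bar>u x\<bar>
      \<le> (4 * pi * real (Suc k)) powr (- (real DIM('a) / 2)) * L1_norm D u"
  proof (subst AE_all_countable, rule allI)
    fix k
    have "exp (lam * real (Suc k)) \<le> 1"
      using lam by (simp add: mult_nonpos_nonneg)
    then have *: "exp (lam * real (Suc k)) * (4 * pi * real (Suc k)) powr (- (real DIM('a) / 2)) * L1_norm D u
        \<le> 1 * (4 * pi * real (Suc k)) powr (- (real DIM('a) / 2)) * L1_norm D u"
      by (intro mult_right_mono) (auto simp: L1_norm_def)
    show "AE x in lebesgue_on D. \<bar>u x\<bar>
        \<le> (4 * pi * real (Suc k)) powr (- (real DIM('a) / 2)) * L1_norm D u"
      using eigenfunction_AE_heat_bound[OF assms, of "real (Suc k)", OF of_nat_0_less_iff[THEN iffD2, OF zero_less_Suc]]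
      by eventually_elim (use * in linarith)
  qed
  have lim: "(\<lambda>k. (4 * pi * real (Suc k)) powr (- (real DIM('a) / 2)) * L1_norm D u) \<longlonglongrightarrow> 0"
  proof (rule tendsto_mult_left_zero)
    have "filterlim (\<lambda>k. 4 * pi * real (Suc k)) at_top sequentially"
      by (intro filterlim_tendsto_pos_mult_at_top[OF tendsto_const]
          filterlim_compose[OF filterlim_real_sequentially filterlim_Suc]) simp
    then show "(\<lambda>k. (4 * pi * real (Suc k)) powr (- (real DIM('a) / 2))) \<longlonglongrightarrow> 0"
      by (intro tendsto_neg_powr) auto
  qed
  from all have "AE x in lebesgue_on D. u x = 0"
  proof eventually_elim
    case (elim x)
    then have "\<bar>u x\<bar> \<le> 0" by (intro LIMSEQ_le_const[OF lim]) auto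
    then show ?case by simp
  qed
  then show False
    using assms(3) by (simp add: dirichlet_eigenpair_def)
qed

text \<open>The choice \<open>t = n / (2 * lam)\<close> minimises \<open>exp (lam * t) * t powr (- n / 2)\<close>. Integrating the
  resulting bound over \<open>D\<close> and dividing by the norm of \<open>u\<close> yields the second claim, a Faber-Krahn type
  lower bound for \<open>lam\<close> in terms of the volume.\<close>

lemma eigenfunction_sup_bound:
  fixes D :: "'a::euclidean_space set"
  assumes "open D" and "bounded D" and "dirichlet_eigenpair D lam u"
  defines "A \<equiv> (exp 1 / (2 * pi * real DIM('a))) powr (real DIM('a) / 2) * lam powr (real DIM('a) / 2)"
  shows "Linf_norm D u \<le> ereal (A * L1_norm D u)" and "1 \<le> A * measure lebesgue D"
proof -
  let ?n = "real DIM('a)"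
  have D: "D \<in> sets lebesgue" using assms(1) by auto
  have lam: "lam > 0" by (rule eigenvalue_pos[OF assms(1-3)])
  have n: "?n > 0" by simp
  have A: "exp (lam * (?n / (2 * lam))) * (4 * pi * (?n / (2 * lam))) powr (- (?n / 2)) = A"
  proof -
    have "exp (lam * (?n / (2 * lam))) = exp 1 powr (?n / 2)"
      using lam by (simp add: powr_def)
    moreover have "(4 * pi * (?n / (2 * lam))) powr (- (?n / 2)) = (lam / (2 * pi * ?n)) powr (?n / 2)"
      unfolding powr_minus using lam n by (simp add: powr_divide powr_mult field_simps)
    moreover have "exp 1 powr (?n / 2) * (lam / (2 * pi * ?n)) powr (?n / 2) = A"
      unfolding A_def using lam n by (simp add: powr_divide powr_mult)
    ultimately show ?thesis by simp
  qed
  have "?n / (2 * lam) > 0" using lam n by simp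
  from eigenfunction_AE_heat_bound[OF assms(1-3) this]
  have bound: "AE x in lebesgue_on D. \<bar>u x\<bar> \<le> A * L1_norm D u"
    unfolding A .
  have uL2: "u \<in> L2 D"
    using assms(3) by (auto simp: dirichlet_eigenpair_def weak_gradient_def)
  then have um: "u \<in> borel_measurable (lebesgue_on D)" by (simp add: L2_def)
  have u_int: "integrable (lebesgue_on D) (\<lambda>x. \<bar>u x\<bar>)"
    using L2_integrable[OF uL2 assms(2) D] by auto
  show "Linf_norm D u \<le> ereal (A * L1_norm D u)"
    unfolding Linf_norm_def
  proof (rule esssup_I)
    show "(\<lambda>x. ereal \<bar>u x\<bar>) \<in> borel_measurable (lebesgue_on D)"
      using um by measurable
    show "AE x in lebesgue_on D. ereal \<bar>u x\<bar> \<le> ereal (A * L1_norm D u)"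
      using bound by simp
  qed
  have "L1_norm D u \<noteq> 0"
  proof
    assume "L1_norm D u = 0"
    then have "AE x in lebesgue_on D. u x = 0"
      using bound by simp
    then show False using assms(3) by (simp add: dirichlet_eigenpair_def)
  qed
  then have pos: "L1_norm D u > 0"
    unfolding L1_norm_def by (simp add: less_le)
  interpret finite_measure "lebesgue_on D"
    by (rule finite_measure_lebesgue_on) (rule bounded_set_imp_lmeasurable[OF assms(2) D])
  have "L1_norm D u \<le> (\<integral>x. A * L1_norm D u \<partial>lebesgue_on D)"
    unfolding L1_norm_def[of D u] by (rule integral_mono_AE) (use u_int bound in \<open>auto simp: L1_norm_def\<close>)
  also have "\<dots> = (A * measure lebesgue D) * L1_norm D u"
    using D by (simp add: measure_restrict_space)
  finally show "1 \<le> A * measure lebesgue D"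
    using pos by simp
qed

section \<open>Comparison of constants\<close>

text \<open>The heat kernel has mass one and is smallest at the rim of the ball. The time
  \<open>s = 1 / (2 * n)\<close> gives the best constant; its product with the factor
  \<open>(exp 1 / (2 * pi * n)) powr (n / 2)\<close> of \<open>eigenfunction_sup_bound\<close> is \<open>(exp 1 / n) ^ n\<close>.\<close>

lemma unit_ball_measure_le:
  "measure lebesgue (ball (0 :: 'a::euclidean_space) 1) \<le> (2 * pi * exp 1 / real DIM('a)) powr (real DIM('a) / 2)"
proof -
  let ?n = "real DIM('a)" and ?B = "ball (0 :: 'a) 1"
  define s where "s = 1 / (2 * ?n)"
  have n: "?n > 0" by simp
  have s: "s > 0" by (simp add: s_def)
  define c where "c = (4 * pi * s) powr (- (?n / 2)) * exp (- (1 / (4 * s)))"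
  have c: "c > 0" using s by (simp add: c_def)
  have "c * measure lborel ?B = (\<integral>z. c * indicator ?B z \<partial>lborel)"
    by simp
  also have "\<dots> \<le> (\<integral>z. heat_kernel s (0 - z :: 'a) \<partial>lborel)"
  proof (rule integral_mono)
    show "integrable lborel (\<lambda>z. c * indicator ?B z)"
      using emeasure_bounded_finite[of ?B] by (intro integrable_mult_right integrable_real_indicator) auto
    show "integrable lborel (\<lambda>z. heat_kernel s (0 - z :: 'a))"
      by (rule integrable_heat_kernel[OF s])
    fix z :: 'a
    show "c * indicator ?B z \<le> heat_kernel s (0 - z)"
    proof (cases "z \<in> ?B")
      case True
      then have "(norm z)\<^sup>2 \<le> 1" by (simp add: power_le_one)
      then have "exp (- (1 / (4 * s))) \<le> exp (- ((norm z)\<^sup>2 / (4 * s)))"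
        using s by (simp add: divide_right_mono)
      then show ?thesis
        using True unfolding heat_kernel_def c_def by (simp add: mult_left_mono)
    qed (use heat_kernel_pos[OF s, of "0 - z"] in simp)
  qed
  also have "\<dots> = 1" by (rule integral_heat_kernel[OF s])
  finally have "c * measure lebesgue ?B \<le> 1" by simp
  moreover have "inverse c = (2 * pi * exp 1 / ?n) powr (?n / 2)"
  proof -
    have "exp (- (1 / (4 * s))) = exp 1 powr (- (?n / 2))"
      by (simp add: s_def powr_def)
    then have "c = ((4 * pi * s) * exp 1) powr (- (?n / 2))"
      using s by (simp add: c_def powr_mult)
    also have "(4 * pi * s) * exp 1 = 2 * pi * exp 1 / ?n"
      using n by (simp add: s_def)
    finally show ?thesis by (simp add: powr_minus)
  qed
  ultimately show ?thesis
    using c by (metis inverse_eq_divide mult.commute pos_le_divide_eq)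
qed

text \<open>The volume inequality bounds \<open>ln R\<close> below by \<open>- ln lam / 2\<close> up to a constant. The tangent to the
  logarithm at \<open>4 * pi\<close>, the point where \<open>lam / (8 * pi\<^sup>2)\<close> and \<open>ln lam / (2 * pi)\<close> have equal slope,
  then makes the terms linear in \<open>lam\<close> cancel.\<close>

lemma planar_constant_le:
  fixes lam R :: real
  assumes lam: "lam > 0" and R: "R > 0" and vol: "4 \<le> exp 1 * lam * R\<^sup>2"
  shows "exp 1 * lam / (4 * pi) \<le> lam * (ln pi + 1 / pi * (1 + ln R) + lam / (8 * pi\<^sup>2))"
proof -
  have "ln 4 \<le> ln (exp 1 * lam * R\<^sup>2)"
    using vol lam R by (subst ln_le_cancel_iff) auto
  also have "\<dots> = 1 + ln lam + 2 * ln R"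
    using lam R by (simp add: ln_mult ln_realpow)
  finally have 1: "ln 4 \<le> 1 + ln lam + 2 * ln R" .
  have "ln (lam / (4 * pi)) \<le> lam / (4 * pi) - 1"
    using lam by (intro ln_le_minus_one) simp
  moreover have "ln (lam / (4 * pi)) = ln lam - ln 4 - ln pi"
    using lam by (simp add: ln_div ln_mult)
  ultimately have "2 * ln R \<ge> - lam / (4 * pi) - ln pi"
    using 1 by simp
  then have "(- lam / (4 * pi) - ln pi) / (2 * pi) \<le> 2 * ln R / (2 * pi)"
    by (intro divide_right_mono) auto
  then have 2: "1 / pi * ln R \<ge> - lam / (8 * pi\<^sup>2) - ln pi / (2 * pi)"
    by (simp add: diff_divide_distrib power2_eq_square)
  have "ln pi \<ge> 0" using pi_gt3 by (intro ln_ge_zero) simp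
  then have 3: "ln pi / (2 * pi) \<le> ln pi"
    using pi_gt3 mult_left_mono[of 1 "2 * pi" "ln pi"] by (simp add: divide_le_eq)
  have "exp 1 / (4 * pi) \<le> 1 / pi"
    using e_less_272 pi_gt3 by (simp add: field_simps)
  also have "1 / pi \<le> ln pi + 1 / pi * (1 + ln R) + lam / (8 * pi\<^sup>2)"
    using 2 3 by (simp add: distrib_left)
  finally have "lam * (exp 1 / (4 * pi)) \<le> lam * (ln pi + 1 / pi * (1 + ln R) + lam / (8 * pi\<^sup>2))"
    using lam by (intro mult_left_mono) auto
  then show ?thesis by (simp add: mult.commute)
qed

text \<open>With \<open>q = sqrt lam * R\<close> the claim only involves \<open>q\<close>. The volume inequality forces
  \<open>q \<ge> n / d\<close>, so the negative term costs, with denominators cleared, at most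
  \<open>2 * n * d ^ (n - 2)\<close>, and the numerical hypothesis on \<open>N\<close> remains. The number \<open>d\<close> is left open
  because \<open>exp 1\<close> works in dimensions above three, whereas dimension three requires a smaller value.\<close>

lemma spatial_constant_le:
  fixes \<omega> R lam a b d N :: real and n :: nat
  assumes n: "n \<ge> 3" and \<omega>: "\<omega> > 0" and R: "R > 0" and lam: "lam > 0" and d: "d > 0"
    and b: "b = a * \<omega>" "b \<le> (d / real n) ^ n"
    and vol: "1 \<le> a * lam powr (real n / 2) * (\<omega> * R ^ n)"
    and N: "d ^ n * (real n - 2) + 2 * real n * d ^ (n - 2) \<le> 2 * N"
  shows "a * lam powr (real n / 2)
    \<le> 2 / (real n ^ n * (real n - 2) * \<omega>) * (lam powr (real n / 2) * N - lam * real n ^ (n - 1) / R ^ (n - 2))"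
proof -
  define l where "l = sqrt lam"
  have l: "l > 0" "lam = l\<^sup>2" using lam by (auto simp: l_def)
  have lpow: "lam powr (real n / 2) = l ^ n"
  proof -
    have "lam powr (real n / 2) = (lam powr (1 / 2)) powr real n" by (simp add: powr_powr)
    then show ?thesis using lam l(1) by (simp add: l_def powr_half_sqrt powr_realpow)
  qed
  define q where "q = l * R"
  have q: "q > 0" using l R by (simp add: q_def)
  have n0: "real n > 0" "real n - 2 > 0" using n by auto
  have bq: "1 \<le> b * q ^ n"
    using vol unfolding lpow b(1) q_def by (simp add: power_mult_distrib mult_ac)
  also have "b * q ^ n \<le> (d / real n) ^ n * q ^ n"
    using b(2) q by (intro mult_right_mono) auto
  finally have "1 ^ n \<le> (d / real n * q) ^ n" by (simp only: power_mult_distrib power_one)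
  then have dq: "1 \<le> d / real n * q"
    using d q n0 n by (subst (asm) power_mono_iff) auto
  have inv: "1 / q ^ (n - 2) \<le> (d / real n) ^ (n - 2)"
  proof -
    have "1 \<le> (d / real n * q) ^ (n - 2)" by (rule one_le_power[OF dq])
    then show ?thesis using q unfolding power_mult_distrib by (simp add: divide_le_eq)
  qed
  have nn: "real n ^ n = real n ^ (n - 2) * (real n)\<^sup>2" "real n ^ (n - 1) = real n ^ (n - 2) * real n"
  proof -
    have "n = (n - 2) + 2" "n - 1 = (n - 2) + 1" using n by auto
    then show "real n ^ n = real n ^ (n - 2) * (real n)\<^sup>2" "real n ^ (n - 1) = real n ^ (n - 2) * real n"
      by (metis power_add, metis power_add power_one_right)
  qed
  have "b * (real n ^ n * (real n - 2)) \<le> (d / real n) ^ n * (real n ^ n * (real n - 2))"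
    using b(2) n0 by (intro mult_right_mono) auto
  also have "\<dots> = d ^ n * (real n - 2)"
    using n0 by (simp add: power_divide)
  finally have 1: "b * (real n ^ n * (real n - 2)) \<le> d ^ n * (real n - 2)" .
  have "real n ^ (n - 1) * (1 / q ^ (n - 2)) \<le> real n ^ (n - 1) * (d / real n) ^ (n - 2)"
    by (intro mult_left_mono inv) auto
  also have "\<dots> = real n * d ^ (n - 2)"
    unfolding nn(2) using n0 by (simp add: power_divide)
  finally have 2: "real n ^ (n - 1) / q ^ (n - 2) \<le> real n * d ^ (n - 2)" by simp
  have main: "b * (real n ^ n * (real n - 2)) \<le> 2 * (N - real n ^ (n - 1) / q ^ (n - 2))"
  proof -
    have "w \<le> 2 * (N - z)" if "w \<le> x" "z \<le> y" "x + 2 * y \<le> 2 * N" for w x y z :: real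
      using that unfolding right_diff_distrib by linarith
    from this[OF 1 2] show ?thesis using N by (simp add: mult.assoc)
  qed
  have "l ^ n * N - lam * real n ^ (n - 1) / R ^ (n - 2) = l ^ n * (N - real n ^ (n - 1) / q ^ (n - 2))"
  proof -
    have "n = (n - 2) + 2" using n by simp
    then have "l ^ n = l ^ (n - 2) * l\<^sup>2" by (metis power_add)
    then have "l ^ n / q ^ (n - 2) = lam / R ^ (n - 2)"
      using l(1) R by (simp add: q_def power_mult_distrib l(2))
    then show ?thesis by (simp add: right_diff_distrib) (metis mult.commute times_divide_eq_right)
  qed
  moreover have "a * l ^ n = b * l ^ n / \<omega>" using \<omega> b(1) by simp
  moreover have "b * l ^ n / \<omega> \<le> 2 / (real n ^ n * (real n - 2) * \<omega>) * (l ^ n * (N - real n ^ (n - 1) / q ^ (n - 2)))"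
  proof -
    define k where "k = real n ^ n * (real n - 2)"
    have k: "k > 0" using n0 by (simp add: k_def)
    have "b * k * (l ^ n / (\<omega> * k)) \<le> 2 * (N - real n ^ (n - 1) / q ^ (n - 2)) * (l ^ n / (\<omega> * k))"
      using main l(1) \<omega> k unfolding k_def[symmetric] by (intro mult_right_mono) auto
    then show ?thesis
      unfolding k_def[symmetric] using k \<omega> by (simp add: mult_ac)
  qed
  ultimately show ?thesis unfolding lpow by simp
qed

lemma exponential_dominates_linear: "11 * real n - 18 \<le> 18 * (4 / 3) ^ n" if "n \<ge> 5"
  using that
proof (induction n rule: dec_induct)
  case base
  then show ?case by (simp add: power_numeral_reduce)
next
  case (step n)
  then have "real n \<ge> 5" by simp
  then have "11 * real (Suc n) - 18 \<le> 4 / 3 * (11 * real n - 18)"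
    unfolding right_diff_distrib of_nat_Suc by simp
  also have "\<dots> \<le> 4 / 3 * (18 * (4 / 3) ^ n)"
    using step.IH by (rule mult_left_mono) simp
  finally show ?case by simp
qed

text \<open>From dimension five on, \<open>exp 1 \<le> 3\<close> and \<open>N \<ge> 4 ^ n\<close> leave an exponential against a linear
  function. In dimension four this is too crude and the value \<open>N = 100\<close> is used.\<close>

lemma dimension_constant_le:
  fixes n :: nat
  assumes n: "n \<ge> 4"
  defines "N \<equiv> ((real n - 1)\<^sup>2 + 1) powr (real n / 2)"
  shows "exp 1 ^ n * (real n - 2) + 2 * real n * exp 1 ^ (n - 2) \<le> 2 * N"
proof (cases "n = 4")
  case True
  have "N = 100" unfolding N_def True by simp
  moreover have "exp 1 ^ 4 \<le> (272 / 100 :: real) ^ 4" "exp 1 ^ 2 \<le> (272 / 100 :: real) ^ 2"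
    using e_less_272 by (intro power_mono; simp)+
  ultimately show ?thesis unfolding True by (simp add: power_numeral_reduce)
next
  case False
  then have n5: "n \<ge> 5" using n by simp
  have "4 ^ n \<le> (real n - 1) ^ n" using n5 by (intro power_mono) auto
  also have "\<dots> = ((real n - 1)\<^sup>2) powr (real n / 2)"
    using n5 by (simp add: powr_powr powr_realpow flip: powr_numeral)
  also have "\<dots> \<le> N" unfolding N_def by (intro powr_mono2) auto
  finally have N: "4 ^ n \<le> N" .
  have e3: "exp 1 \<le> (3::real)" using e_less_272 by simp
  have "exp 1 ^ n * (real n - 2) + 2 * real n * exp 1 ^ (n - 2) \<le> 3 ^ n * (real n - 2) + 2 * real n * 3 ^ (n - 2)"
    using e3 n5 by (intro add_mono mult_right_mono mult_left_mono power_mono) auto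
  also have "3 ^ (n - 2) = (3 ^ n / 9 :: real)"
    using n5 by (simp add: power_diff)
  also have "3 ^ n * (real n - 2) + 2 * real n * (3 ^ n / 9) = 3 ^ n / 9 * (11 * real n - 18)"
    by (simp add: algebra_simps)
  also have "\<dots> \<le> 3 ^ n / 9 * (18 * (4 / 3) ^ n)"
    by (intro mult_left_mono exponential_dominates_linear n5) auto
  also have "\<dots> = 2 * 4 ^ n" by (simp add: power_divide)
  finally show ?thesis using N by linarith
qed

text \<open>For \<open>n = 3\<close> and \<open>d = exp 1\<close> the hypothesis on \<open>N\<close> of \<open>spatial_constant_le\<close> fails. The exact volume
  \<open>4 / 3 * pi\<close> of the ball permits \<open>d = 2\<close>.\<close>

lemma three_dimensional_constants:
  shows "(exp 1 / (2 * pi * 3)) powr (3 / 2) * (4 / 3 * pi) \<le> (2 / 3 :: real) ^ 3"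
    and "2 ^ 3 * (3 - 2) + 2 * 3 * 2 ^ 1 \<le> 2 * (((3 - 1)\<^sup>2 + 1 :: real) powr (3 / 2))"
proof -
  have "((exp 1 / (2 * pi * 3)) powr (3 / 2) * (4 / 3 * pi))\<^sup>2 = (exp 1 / (2 * pi * 3)) ^ 3 * (4 / 3 * pi)\<^sup>2"
  proof -
    have "((exp 1 / (2 * pi * 3)) powr (3 / 2))\<^sup>2 = (exp 1 / (2 * pi * 3)) powr (3 / 2 * 2)"
      by (simp add: powr_power)
    also have "\<dots> = (exp 1 / (2 * pi * 3)) ^ 3"
      by simp
    finally show ?thesis unfolding power_mult_distrib by simp
  qed
  also have "\<dots> = exp 1 ^ 3 * (2 / (243 * pi))"
    by (simp add: power2_eq_square power3_eq_cube field_simps)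
  also have "\<dots> \<le> 3 ^ 3 * (2 / (243 * 3))"
    using e_less_272 pi_gt3 by (intro mult_mono power_mono frac_le) auto
  also have "\<dots> \<le> ((2 / 3) ^ 3)\<^sup>2"
    by (simp add: power_numeral_reduce)
  finally show "(exp 1 / (2 * pi * 3)) powr (3 / 2) * (4 / 3 * pi) \<le> (2 / 3 :: real) ^ 3"
    by (rule power2_le_imp_le) simp
  have "(5::real) powr (3 / 2) = 5 powr 1 * 5 powr (1 / 2)"
    by (subst powr_add[symmetric]) simp
  also have "\<dots> = 5 * sqrt 5" by (simp add: powr_half_sqrt)
  also have "\<dots> \<ge> 5 * 2" by (intro mult_left_mono real_le_rsqrt) auto
  finally have "(5::real) powr (3 / 2) \<ge> 10" by simp
  then show "2 ^ 3 * (3 - 2) + 2 * 3 * 2 ^ 1 \<le> 2 * (((3 - 1)\<^sup>2 + 1 :: real) powr (3 / 2))"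
    by simp
qed

theorem theorem2p5:
  fixes D :: "(real ^ 'n) set" and n :: nat and \<omega> R :: real
    and lam :: real and u :: "real ^ 'n \<Rightarrow> real"
  assumes "n = CARD('n)" and "n \<ge> 2"
    and "bounded D" and "connected D" and "open D" and "lipschitz_boundary D"
    and "\<omega> = measure lebesgue (ball (0 :: real ^ 'n) 1)"
    and "R = (measure lebesgue D / \<omega>) powr (1 / real n)"
    and "dirichlet_eigenpair D lam u"
  shows "(n > 2 \<longrightarrow>
            Linf_norm D u \<le>
              ereal (2 / (real n ^ n * (real n - 2) * \<omega>)
                * (lam powr (real n / 2) * ((real n - 1)\<^sup>2 + 1) powr (real n / 2)
                   - lam * real n ^ (n - 1) / R ^ (n - 2))
                * L1_norm D u))
       \<and> (n = 2 \<longrightarrow>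
            Linf_norm D u \<le>
              ereal (lam * (ln pi + 1 / pi * (1 + ln R) + lam / (8 * pi\<^sup>2)) * L1_norm D u))"
proof -
  have dim: "DIM(real ^ 'n) = n" using assms(1) by simp
  define a where "a = (exp 1 / (2 * pi * real n)) powr (real n / 2)"
  define A where "A = a * lam powr (real n / 2)"
  have lam: "lam > 0" by (rule eigenvalue_pos[OF assms(5,3,9)])
  have sup: "Linf_norm D u \<le> ereal (A * L1_norm D u)" and vol: "1 \<le> A * measure lebesgue D"
    using eigenfunction_sup_bound[OF assms(5,3,9)] unfolding dim A_def a_def by simp_all
  have \<omega>_ball: "\<omega> = unit_ball_vol (real n)"
    unfolding assms(7) using content_ball[of 1 "0 :: real ^ 'n"] dim by simp
  have \<omega>: "\<omega> > 0" by (simp add: \<omega>_ball)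
  have D0: "measure lebesgue D > 0"
    using vol by (cases "measure lebesgue D = 0") (auto simp: zero_less_measure_iff)
  have R: "R > 0" using D0 \<omega> by (simp add: assms(8))
  have Rn: "measure lebesgue D = \<omega> * R ^ n"
  proof -
    have "R ^ n = measure lebesgue D / \<omega>"
      using assms(2) D0 \<omega> by (simp add: assms(8) powr_power)
    then show ?thesis using \<omega> by simp
  qed
  have enlarge: "Linf_norm D u \<le> ereal (B * L1_norm D u)" if "A \<le> B" for B
  proof (rule order_trans[OF sup])
    have "A * L1_norm D u \<le> B * L1_norm D u"
      using that by (intro mult_right_mono) (auto simp: L1_norm_def)
    then show "ereal (A * L1_norm D u) \<le> ereal (B * L1_norm D u)" by simp
  qed
  have planar: "A \<le> lam * (ln pi + 1 / pi * (1 + ln R) + lam / (8 * pi\<^sup>2))" if "n = 2"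
  proof -
    have \<omega>2: "\<omega> = pi" unfolding \<omega>_ball that using unit_ball_vol_2 by simp
    have A2: "A = exp 1 * lam / (4 * pi)"
      unfolding A_def a_def that using lam by simp
    have "4 \<le> exp 1 * lam * R\<^sup>2"
      using vol unfolding Rn \<omega>2 A2 that by (simp add: field_simps)
    then show ?thesis unfolding A2 by (rule planar_constant_le[OF lam R])
  qed
  have spatial: "A \<le> 2 / (real n ^ n * (real n - 2) * \<omega>)
      * (lam powr (real n / 2) * ((real n - 1)\<^sup>2 + 1) powr (real n / 2)
         - lam * real n ^ (n - 1) / R ^ (n - 2))" if "n > 2"
  proof -
    have n3: "n \<ge> 3" using that by simp
    note bound = spatial_constant_le[OF n3 \<omega> R lam _ refl _ vol[unfolded A_def Rn], folded A_def]
    show ?thesis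
    proof (cases "n = 3")
      case True
      show ?thesis
      proof (rule bound[of 2])
        show "a * \<omega> \<le> (2 / real n) ^ n"
          unfolding a_def \<omega>_ball True of_nat_numeral unit_ball_vol_3
          by (rule three_dimensional_constants(1))
        show "2 ^ n * (real n - 2) + 2 * real n * 2 ^ (n - 2)
            \<le> 2 * ((real n - 1)\<^sup>2 + 1) powr (real n / 2)"
          unfolding True using three_dimensional_constants(2) by simp
      qed simp
    next
      case False
      then have n4: "n \<ge> 4" using n3 by simp
      show ?thesis
      proof (rule bound[of "exp 1"])
        have "a * \<omega> \<le> a * (2 * pi * exp 1 / real n) powr (real n / 2)"
          using unit_ball_measure_le[where 'a="real ^ 'n"] unfolding dim assms(7)
          by (intro mult_left_mono) (auto simp: a_def)
        also have "\<dots> = (exp 1 / (2 * pi * real n) * (2 * pi * exp 1 / real n)) powr (real n / 2)"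
          unfolding a_def by (rule powr_mult[symmetric])
        also have "exp 1 / (2 * pi * real n) * (2 * pi * exp 1 / real n) = (exp 1 / real n) powr 2"
          using n4 by (simp add: power2_eq_square)
        also have "((exp 1 / real n) powr 2) powr (real n / 2) = (exp 1 / real n) ^ n"
          using n4 by (simp only: powr_powr) (simp add: powr_realpow)
        finally show "a * \<omega> \<le> (exp 1 / real n) ^ n" .
      qed (use dimension_constant_le[OF n4] in auto)
    qed
  qed
  show ?thesis
    using enlarge planar spatial by blast
qed

end
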